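(* Let $(X,\|\cdot\|)$ be a normed plane endowed with a nondegenerate symplectic form $\omega$, and let $\|\cdot\|_a$ be the associated anti-norm. Let $\gamma(s)$ be a closed, smooth, simple curve in $X$ parametrized by arc-length in the anti-norm and with everywhere positive circular curvature $k_c$ (circular curvature in the norm $\|\cdot\|$). Denote by $\lambda(D)$ the area (given by $\omega$) of the region $D$ enclosed by $\gamma$. Then $$2\lambda(D)\ \le\ \int_0^{l_a(\gamma)}\frac{1}{k_c(s)}\,ds,$$ where $l_a(\gamma)$ is the length of $\gamma$ measured in the anti-norm. Equality holds if and only if $\gamma$ is a circle of the norm $\|\cdot\|$.
   Context: $X$ is a two-dimensional real vector space with norm $\|\cdot\|$, whose unit circle $S=\{x:\|x\|=1\}$ is assumed to be a smooth regular curve. The form $\omega:X\times X\to\mathbb{R}$ induces an area element and an orientation in $X$. The anti-norm is $\|x\|_a=\sup\{\omega(x,y):y\in S\}$. Circular curvature: let $\varphi(t)$ be a parametrization of $S$ by arc-length in $\|\cdot\|$; for a smooth regular curve $\gamma(\sigma)$ parametrized by arc-length $\sigma$ in $\|\cdot\|$, choose a smooth function $t(\sigma)$ with $\gamma'(\sigma)=\frac{d\varphi}{dt}(t(\sigma))$; the circular curvature at $\gamma(\sigma)$ is $k_c=t'(\sigma)$. For $\gamma$ parametrized by anti-norm arc-length $s$, $k_c(s)$ means the circular curvature at the point $\gamma(s)$. A circle of the norm is a set $\{x:\|x-a\|=r\}$, $a\in X$, $r>0$.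
   Formalization: The circular curvature is required not to depend on the choice of t(σ), which excludes unit circles containing segments; there k_c is ambiguous, and for γ = S with t not affine along a segment the equality claim fails. *)

theory Defs
  imports "HOL-Analysis.Analysis"
begin

definition symplectic_form :: "('a::real_vector \<Rightarrow> 'a \<Rightarrow> real) \<Rightarrow> bool" where
  "symplectic_form \<omega> \<longleftrightarrow>
     bilinear \<omega> \<and> (\<forall>x. \<omega> x x = 0) \<and> (\<forall>x. (\<forall>y. \<omega> x y = 0) \<longrightarrow> x = 0)"

definition anti_norm :: "('a::real_normed_vector \<Rightarrow> 'a \<Rightarrow> real) \<Rightarrow> 'a \<Rightarrow> real" where
  "anti_norm \<omega> x = (SUP y\<in>sphere 0 1. \<omega> x y)"

(* Lebesgue measure in coordinates with respect to a basis (u, v) with \<omega> u v = 1. Any two such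
   bases differ by a linear map of determinant 1, so the value does not depend on the choice. *)
definition area :: "('a::real_vector \<Rightarrow> 'a \<Rightarrow> real) \<Rightarrow> 'a set \<Rightarrow> real" where
  "area \<omega> D =
     (let (u, v) = (SOME (u, v). \<omega> u v = 1)
      in measure lebesgue {z :: real \<times> real. fst z *\<^sub>R u + snd z *\<^sub>R v \<in> D})"

(* "Smooth" means infinitely differentiable; d n is the n-th derivative. *)
definition smooth :: "(real \<Rightarrow> 'a::real_normed_vector) \<Rightarrow> bool" where
  "smooth f \<longleftrightarrow>
     (\<exists>d :: nat \<Rightarrow> real \<Rightarrow> 'a. d 0 = f \<and>
        (\<forall>n x. (d n has_vector_derivative d (Suc n) x) (at x)))"

definition curve_length ::
    "('a::real_normed_vector \<Rightarrow> real) \<Rightarrow> (real \<Rightarrow> 'a) \<Rightarrow> real \<Rightarrow> real \<Rightarrow> real" where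
  "curve_length N c a b = integral {a..b} (\<lambda>s. N (vector_derivative c (at s)))"

definition arc_length_param :: "('a::real_normed_vector \<Rightarrow> real) \<Rightarrow> (real \<Rightarrow> 'a) \<Rightarrow> bool" where
  "arc_length_param N c \<longleftrightarrow> (\<forall>s. N (vector_derivative c (at s)) = 1)"

(* The existence of such a \<phi> says precisely that the unit circle is a smooth regular curve.
   Both orientations of \<phi> are allowed. *)
definition unit_circle_param :: "(real \<Rightarrow> 'a::real_normed_vector) \<Rightarrow> bool" where
  "unit_circle_param \<phi> \<longleftrightarrow>
     smooth \<phi> \<and> arc_length_param norm \<phi> \<and> range \<phi> = sphere 0 1"

(* A closed curve is a p-periodic map on the whole line; one period is traversed on {0..p}. *)
definition smooth_simple_closed :: "(real \<Rightarrow> 'a::real_normed_vector) \<Rightarrow> real \<Rightarrow> bool" where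
  "smooth_simple_closed c p \<longleftrightarrow>
     p > 0 \<and> smooth c \<and> (\<forall>s. c (s + p) = c s) \<and> inj_on c {0..<p}"

definition tangent_lift ::
    "(real \<Rightarrow> 'a::real_normed_vector) \<Rightarrow> (real \<Rightarrow> 'a) \<Rightarrow> (real \<Rightarrow> real) \<Rightarrow> bool" where
  "tangent_lift \<phi> c t \<longleftrightarrow>
     smooth t \<and>
     (\<forall>\<sigma>. vector_derivative c (at \<sigma>) = vector_derivative \<phi> (at (t \<sigma>)))"

(* For a curve c parametrized by arc-length in the norm, \<kappa> is the derivative of a smooth t with
   c' = \<phi>' o t. The second conjunct makes \<kappa> well defined, i.e. independent of the choice of t.
   If the unit circle contains no segment this is automatic, since t is then unique up to a
   constant; along a segment \<phi>' is constant and t could be changed arbitrarily. *)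
definition circular_curvature_arc ::
    "(real \<Rightarrow> 'a::real_normed_vector) \<Rightarrow> (real \<Rightarrow> 'a) \<Rightarrow> (real \<Rightarrow> real) \<Rightarrow> bool" where
  "circular_curvature_arc \<phi> c \<kappa> \<longleftrightarrow>
     (\<exists>t. tangent_lift \<phi> c t) \<and>
     (\<forall>t. tangent_lift \<phi> c t \<longrightarrow> (\<forall>\<sigma>. (t has_real_derivative \<kappa> \<sigma>) (at \<sigma>)))"

(* For an arbitrary regular parametrization c: k s is the circular curvature at the point c s,
   computed in an orientation preserving reparametrization s = h \<sigma> by arc-length in the norm. *)
definition circular_curvature ::
    "(real \<Rightarrow> 'a::real_normed_vector) \<Rightarrow> (real \<Rightarrow> 'a) \<Rightarrow> (real \<Rightarrow> real) \<Rightarrow> bool" where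
  "circular_curvature \<phi> c k \<longleftrightarrow>
     (\<exists>h. smooth h \<and> (\<forall>\<sigma>. deriv h \<sigma> > 0) \<and> surj h \<and>
          arc_length_param norm (c \<circ> h) \<and> circular_curvature_arc \<phi> (c \<circ> h) (k \<circ> h))"

end

theory Submission
  imports Defs
begin

text \<open>
  Let \<open>\<eta> s\<close> be the unit vector at which the tangent of the unit circle is parallel to \<open>\<gamma>' s\<close>;
  then \<open>\<eta>' = k *\<^sub>R \<gamma>'\<close>, and after a choice of sign \<open>\<omega> (\<eta> s) (\<gamma>' s) = 1\<close>. A point \<open>x\<close> of the
  enclosed region at distance \<open>r\<close> from the curve has a nearest point \<open>\<gamma> s\<close>; the tangents of the curve
  and of the ball about \<open>x\<close> agree there, so \<open>x = \<gamma> s - r *\<^sub>R \<eta> s\<close>, and comparison of curvatures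
  gives \<open>r \<le> 1 / k s\<close>. The region is thus covered by the image of \<open>{(s, r). 0 \<le> r \<le> 1 / k s}\<close> under
  the map \<open>(s, r) \<mapsto> \<gamma> s - r *\<^sub>R \<eta> s\<close>, whose Jacobian is \<open>1 - r * k s\<close>, and the integral of the Jacobian
  is half the integral of \<open>1 / k\<close>. This is the Heintze-Karcher argument; it needs neither the convexity
  of the curve nor Green's theorem.

  In the case of equality no open set of pairs \<open>(s, r)\<close> can be superfluous for the covering, so the curve
  does not enter any of its osculating circles. It would do so wherever \<open>k\<close> is strictly monotone, hence
  \<open>k\<close> is constant.
\<close>

section \<open>Smooth bump functions\<close>

text \<open>The unit circle is smooth but may contain segments, while the argument needs
  \<open>\<eta> s\<close> to be the only unit vector at which the line in direction
  \<open>\<gamma>' s\<close> supports the unit ball. This uniqueness is extracted from the curvature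
  being well defined: over a segment \<open>\<phi>'\<close> is constant, so adding a small bump to a
  lift \<open>t\<close> gives another lift with another derivative. The bump functions serve this
  purpose alone. Differentiability of the norm off the origin is read off from the unit circle. Only
  first derivatives of the norm occur: where the pairing
  \<open>B (\<eta> s) (\<gamma> s - x)\<close> is nonzero, the derivative of
  \<open>norm (\<gamma> s - x)\<close> has the same sign, and the derivative of the pairing brings
  in the curvature. That a point is not enclosed is always shown by a connected unbounded set
  through it that avoids the curve. The unit circle may be traversed in either direction; replacing
  \<open>\<omega>\<close> by its negative where necessary makes all signs positive and changes
  neither areas nor anti-norms.\<close>

lemma smooth_if_closed:
  fixes f :: "real \<Rightarrow> 'a::real_normed_vector"
  assumes "P f"
    and step: "\<And>g. P g \<Longrightarrow> \<exists>g'. P g' \<and> (\<forall>x. (g has_vector_derivative g' x) (at x))"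
  shows "smooth f"
proof -
  obtain D where D: "\<And>g. P g \<Longrightarrow> P (D g) \<and> (\<forall>x. (g has_vector_derivative D g x) (at x))"
    using step by metis
  have P: "P ((D ^^ n) f)" for n
    by (induction n) (use \<open>P f\<close> D in auto)
  then show ?thesis
    unfolding smooth_def using D by (intro exI[of _ "\<lambda>n. (D ^^ n) f"]) auto
qed

lemma smooth_has_vector_derivative:
  "smooth f \<Longrightarrow> \<exists>f'. smooth f' \<and> (\<forall>x. (f has_vector_derivative f' x) (at x))"
  unfolding smooth_def
proof (elim exE conjE)
  fix d assume d: "d 0 = f" "\<forall>n x. (d n has_vector_derivative d (Suc n) x) (at x)"
  then show "\<exists>f'. (\<exists>d. d 0 = f' \<and> (\<forall>n x. (d n has_vector_derivative d (Suc n) x) (at x))) \<and>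
      (\<forall>x. (f has_vector_derivative f' x) (at x))"
    by (intro exI[of _ "d 1"] conjI exI[of _ "\<lambda>n. d (Suc n)"]) auto
qed

text \<open>The class closed under differentiation consists of the sums of two smooth
  functions.\<close>

lemma smooth_add:
  assumes "smooth f" "smooth g"
  shows "smooth (\<lambda>x. f x + g x)"
proof -
  let ?P = "\<lambda>h. \<exists>f g. smooth f \<and> smooth g \<and> h = (\<lambda>x. f x + g x)"
  show ?thesis
  proof (rule smooth_if_closed[where P = ?P])
    fix h assume "?P h"
    then obtain f g where fg: "smooth f" "smooth g" "h = (\<lambda>x. f x + g x)" by blast
    obtain f' g' where "smooth f'" "smooth g'"
      "\<And>x. (f has_vector_derivative f' x) (at x)" "\<And>x. (g has_vector_derivative g' x) (at x)"
      using fg smooth_has_vector_derivative by metis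
    then show "\<exists>h'. ?P h' \<and> (\<forall>x. (h has_vector_derivative h' x) (at x))"
      unfolding fg(3)
      by (intro exI[of _ "\<lambda>x. f' x + g' x"]) (auto intro!: derivative_eq_intros)
  qed (use assms in blast)
qed

text \<open>The derivative of a product is a sum of two products, so products alone are not closed
  under differentiation, whereas their finite sums are.\<close>

inductive product_sum :: "(real \<Rightarrow> real) \<Rightarrow> bool" where
  product: "smooth f \<Longrightarrow> smooth g \<Longrightarrow> product_sum (\<lambda>x. f x * g x)"
| sum: "product_sum f \<Longrightarrow> product_sum g \<Longrightarrow> product_sum (\<lambda>x. f x + g x)"

lemma smooth_mult:
  fixes f g :: "real \<Rightarrow> real"
  assumes "smooth f" "smooth g"
  shows "smooth (\<lambda>x. f x * g x)"
proof (rule smooth_if_closed[where P = product_sum])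
  fix h assume "product_sum h"
  then show "\<exists>h'. product_sum h' \<and> (\<forall>x. (h has_vector_derivative h' x) (at x))"
  proof induction
    case (product f g)
    obtain f' g' where "smooth f'" "smooth g'"
      and d: "\<And>x. (f has_vector_derivative f' x) (at x)" "\<And>x. (g has_vector_derivative g' x) (at x)"
      using product smooth_has_vector_derivative by metis
    then have "product_sum (\<lambda>x. f x * g' x + f' x * g x)"
      using product by (intro product_sum.intros)
    then show ?case
      using d has_vector_derivative_mult by blast
  next
    case (sum f g)
    then obtain f' g' where "product_sum f'" "product_sum g'"
      "\<And>x. (f has_vector_derivative f' x) (at x)" "\<And>x. (g has_vector_derivative g' x) (at x)"
      by blast
    then show ?case
      by (intro exI[of _ "\<lambda>x. f' x + g' x"])
        (auto intro!: product_sum.intros derivative_eq_intros)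
  qed
qed (use assms in \<open>rule product_sum.intros\<close>)

lemma smooth_affine:
  fixes f :: "real \<Rightarrow> real"
  assumes "smooth f"
  shows "smooth (\<lambda>x. c * f (m * x + b))"
proof -
  let ?P = "\<lambda>h. \<exists>c (f :: real \<Rightarrow> real). smooth f \<and> h = (\<lambda>x. c * f (m * x + b))"
  show ?thesis
  proof (rule smooth_if_closed[where P = ?P])
    fix h assume "?P h"
    then obtain c f where f: "smooth f" "h = (\<lambda>x. c * f (m * x + b))" by blast
    obtain f' where f': "smooth f'" "\<And>x. (f has_real_derivative f' x) (at x)"
      using smooth_has_vector_derivative[OF f(1)]
      by (auto simp: has_real_derivative_iff_has_vector_derivative)
    have "(h has_real_derivative (c * m) * f' (m * x + b)) (at x)" for x
      unfolding f by (auto intro!: derivative_eq_intros DERIV_chain2[OF f'(2)])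
    then show "\<exists>h'. ?P h' \<and> (\<forall>x. (h has_vector_derivative h' x) (at x))"
      using f'(1) unfolding has_real_derivative_iff_has_vector_derivative
      by (intro exI[of _ "\<lambda>x. (c * m) * f' (m * x + b)"]) blast
  qed (use assms in blast)
qed

text \<open>For \<open>P = 1\<close> this is the classical function that is flat at 0. The
  polynomial in \<open>1 / x\<close> makes the family closed under differentiation.\<close>

definition flat_exp :: "real poly \<Rightarrow> real \<Rightarrow> real" where
  "flat_exp P x = (if x \<le> 0 then 0 else poly P (1 / x) * exp (- (1 / x)))"

lemma poly_mult_exp_minus_tendsto_0: "((\<lambda>y::real. poly P y * exp (- y)) \<longlongrightarrow> 0) at_top"
proof -
  have "((\<lambda>y. \<Sum>i\<le>degree P. coeff P i * (y ^ i / exp y)) \<longlongrightarrow> (\<Sum>i\<le>degree P. coeff P i * 0)) at_top"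
    by (intro tendsto_intros tendsto_power_div_exp_0)
  then show ?thesis
    by (simp add: poly_altdef exp_minus field_simps sum_divide_distrib)
qed

text \<open>For positive \<open>x\<close> the inner derivative of \<open>1 / x\<close> contributes a
  factor \<open>1 / x\<close> squared, which is the polynomial \<open>[:0, 0, 1:]\<close> evaluated
  at \<open>1 / x\<close>. At 0 the difference quotient belongs to \<open>pCons 0 P\<close>, and the
  exponential beats every polynomial in \<open>1 / h\<close>.\<close>

lemma flat_exp_has_real_derivative:
  "(flat_exp P has_real_derivative flat_exp ([:0, 0, 1:] * (P - pderiv P)) x) (at x)"
proof -
  let ?Q = "[:0, 0, 1:] * (P - pderiv P)"
  consider "x < 0" | "x > 0" | "x = 0" by linarith
  then show ?thesis
  proof cases
    case 1
    have "((\<lambda>x. 0) has_real_derivative flat_exp ?Q x) (at x)"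
      using 1 by (simp add: flat_exp_def)
    then show ?thesis
      by (rule has_field_derivative_transform_within_open[where S = "{..<0}"])
        (use 1 in \<open>auto simp: flat_exp_def\<close>)
  next
    case 2
    have "((\<lambda>x. poly P (1 / x) * exp (- (1 / x))) has_real_derivative
        poly P (1 / x) * (exp (- (1 / x)) * (1 / x\<^sup>2)) +
        (poly (pderiv P) (1 / x) * (- (1 / x\<^sup>2))) * exp (- (1 / x))) (at x)"
      using 2 by (auto intro!: derivative_eq_intros DERIV_chain2[OF poly_DERIV]
          simp: power2_eq_square field_simps)
    also have "poly P (1 / x) * (exp (- (1 / x)) * (1 / x\<^sup>2)) +
        (poly (pderiv P) (1 / x) * (- (1 / x\<^sup>2))) * exp (- (1 / x)) = flat_exp ?Q x"
      using 2 by (simp add: flat_exp_def field_simps power2_eq_square)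
    finally show ?thesis
      by (rule has_field_derivative_transform_within_open[where S = "{0<..}"])
        (use 2 in \<open>auto simp: flat_exp_def\<close>)
  next
    case 3
    have "((\<lambda>h. flat_exp P h / h) \<longlongrightarrow> 0) (at_right 0)"
    proof -
      have "((\<lambda>h. poly (pCons 0 P) (inverse h) * exp (- inverse h)) \<longlongrightarrow> 0) (at_right (0::real))"
        by (rule filterlim_compose[OF poly_mult_exp_minus_tendsto_0 filterlim_inverse_at_top_right])
      moreover have "\<forall>\<^sub>F h in at_right (0::real).
          poly (pCons 0 P) (inverse h) * exp (- inverse h) = flat_exp P h / h"
        by (auto simp: eventually_at_right_field flat_exp_def divide_inverse intro!: exI[of _ 1])
      ultimately show ?thesis
        by (rule Lim_transform_eventually)
    qed
    moreover have "((\<lambda>h. flat_exp P h / h) \<longlongrightarrow> 0) (at_left 0)"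
      by (rule tendsto_eventually)
        (auto simp: eventually_at_left_field flat_exp_def intro!: exI[of _ "-1"])
    ultimately have "((\<lambda>h. flat_exp P h / h) \<longlongrightarrow> 0) (at 0)"
      by (simp add: filterlim_split_at)
    then show ?thesis
      using 3 by (simp add: DERIV_def flat_exp_def)
  qed
qed

lemma smooth_flat_exp: "smooth (flat_exp P)"
  by (rule smooth_if_closed[where P = "\<lambda>h. \<exists>P. h = flat_exp P"])
    (use flat_exp_has_real_derivative in
      \<open>fastforce simp: has_real_derivative_iff_has_vector_derivative\<close>)+

lemma smooth_bump:
  fixes a b c :: real
  assumes "a < b" "c > 0"
  obtains g where "smooth g" "\<And>x. 0 \<le> g x" "\<And>x. g x \<le> c"
    "\<And>x. x \<le> a \<or> b \<le> x \<Longrightarrow> g x = 0" "\<And>x. a < x \<Longrightarrow> x < b \<Longrightarrow> g x > 0"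
proof
  let ?f = "flat_exp 1"
  \<comment> \<open>Each factor is written in the form \<open>c * f (m * x + b)\<close> of
    \<open>smooth_affine\<close>. Both exponential factors are at most 1, so \<open>c\<close> bounds
    the product.\<close>
  let ?g = "\<lambda>x. (c * ?f (1 * x + (- a))) * (1 * ?f ((- 1) * x + b))"
  show "smooth ?g"
    by (intro smooth_mult smooth_affine smooth_flat_exp)
  have f: "0 \<le> ?f x" "?f x \<le> 1" "x \<le> 0 \<Longrightarrow> ?f x = 0" "x > 0 \<Longrightarrow> ?f x > 0" for x
    by (auto simp: flat_exp_def)
  show "0 \<le> ?g x" for x
    using f assms by simp
  show "?g x \<le> c" for x
  proof -
    have "?f (x - a) * ?f (b - x) \<le> 1 * 1"
      using f by (intro mult_mono) auto
    then show ?thesis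
      using assms(2) mult_left_mono[of "?f (x - a) * ?f (b - x)" 1 c] by (simp add: mult.assoc)
  qed
  show "x \<le> a \<or> b \<le> x \<Longrightarrow> ?g x = 0" for x
    using f(3)[of "x - a"] f(3)[of "b - x"] by auto
  show "a < x \<Longrightarrow> x < b \<Longrightarrow> ?g x > 0" for x
    using f(4)[of "x - a"] f(4)[of "b - x"] assms(2) by simp
qed

section \<open>The unit circle of a normed plane\<close>

text \<open>Dimension two enters as the identity \<open>expansion\<close>: three vectors of a plane
  are linearly dependent, with values of \<open>B\<close> as coefficients. It is Cramer's rule for
  any two vectors with \<open>B a b \<noteq> 0\<close>.\<close>

locale symplectic_plane = bounded_bilinear B
  for B :: "'a::real_normed_vector \<Rightarrow> 'a \<Rightarrow> real" +
  assumes alternating [simp]: "B x x = 0"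
    and nondegenerate: "x \<noteq> 0 \<Longrightarrow> \<exists>z. B x z \<noteq> 0"
    and expansion: "B a b *\<^sub>R x = B x b *\<^sub>R a + B a x *\<^sub>R b"
begin

lemma antisymmetric: "B y x = - B x y"
  using alternating[of "x + y", unfolded add_left add_right] by simp

lemma coordinates:
  assumes "B a b \<noteq> 0"
  shows "x = (B x b / B a b) *\<^sub>R a + (B a x / B a b) *\<^sub>R b"
proof -
  have "x = (1 / B a b) *\<^sub>R (B a b *\<^sub>R x)"
    using assms by simp
  also have "\<dots> = (1 / B a b) *\<^sub>R (B x b *\<^sub>R a + B a x *\<^sub>R b)"
    by (simp only: expansion[of a b x])
  finally show ?thesis
    by (simp add: scaleR_add_right)
qed

end

text \<open>The main work is the continuity of \<open>\<omega>\<close>. Coordinates with respect to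
  a basis are bounded by the norm, because the norm has a positive minimum over the compact unit
  sphere of \<open>real \<times> real\<close>.\<close>

lemma symplectic_plane_if_symplectic_form:
  fixes \<omega> :: "'a::real_normed_vector \<Rightarrow> 'a \<Rightarrow> real"
  assumes "dim (UNIV :: 'a set) = 2" "symplectic_form \<omega>"
  shows "symplectic_plane \<omega>"
proof -
  have bl: "bilinear \<omega>" and alt: "\<And>x. \<omega> x x = 0" and nd: "\<And>x. (\<forall>y. \<omega> x y = 0) \<Longrightarrow> x = 0"
    using assms(2) by (auto simp: symplectic_form_def)
  note expand = bilinear_ladd[OF bl] bilinear_radd[OF bl] bilinear_lmul[OF bl] bilinear_rmul[OF bl]
    bilinear_lzero[OF bl] bilinear_rzero[OF bl]
  have anti: "\<omega> y x = - \<omega> x y" for x y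
    using alt[of "x + y", unfolded bilinear_ladd[OF bl] bilinear_radd[OF bl]] by (simp add: alt)
  obtain S :: "'a set" where "independent S" "UNIV \<subseteq> span S" "card S = dim (UNIV :: 'a set)"
    by (rule basis_exists[of UNIV])
  then have S: "independent S" "span S = UNIV" "card S = 2"
    by (simp_all add: assms(1) top.extremum_unique)
  then obtain e f where ef: "S = {e, f}" "e \<noteq> f"
    by (auto simp: card_2_iff)
  have span: "\<exists>x1 x2. x = x1 *\<^sub>R e + x2 *\<^sub>R f" for x
  proof -
    have "x \<in> span {e, f}" using S ef by auto
    then obtain x1 where "x - x1 *\<^sub>R e \<in> span {f}"
      unfolding span_insert[of e] by auto
    then obtain x2 where "x - x1 *\<^sub>R e = x2 *\<^sub>R f"
      unfolding span_singleton by auto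
    then show ?thesis by (metis diff_eq_eq add.commute)
  qed
  have formula: "\<omega> (a1 *\<^sub>R e + a2 *\<^sub>R f) (b1 *\<^sub>R e + b2 *\<^sub>R f) = (a1 * b2 - a2 * b1) * \<omega> e f"
    for a1 a2 b1 b2
    by (simp add: expand alt anti[of e f] algebra_simps)
  have expansion: "\<omega> a b *\<^sub>R x = \<omega> x b *\<^sub>R a + \<omega> a x *\<^sub>R b" for a b x
  proof -
    obtain a1 a2 b1 b2 x1 x2 where eq: "a = a1 *\<^sub>R e + a2 *\<^sub>R f" "b = b1 *\<^sub>R e + b2 *\<^sub>R f"
      "x = x1 *\<^sub>R e + x2 *\<^sub>R f"
      using span[of a] span[of b] span[of x] by blast
    have *: "(a1 * b2 - a2 * b1) * x1 = (x1 * b2 - x2 * b1) * a1 + (a1 * x2 - a2 * x1) * b1"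
      "(a1 * b2 - a2 * b1) * x2 = (x1 * b2 - x2 * b1) * a2 + (a1 * x2 - a2 * x1) * b2"
      by algebra+
    have "\<omega> a b *\<^sub>R x = \<omega> e f *\<^sub>R (((a1 * b2 - a2 * b1) * x1) *\<^sub>R e + ((a1 * b2 - a2 * b1) * x2) *\<^sub>R f)"
      unfolding eq formula by (simp add: scaleR_add_right mult_ac)
    also have "\<dots> = \<omega> x b *\<^sub>R a + \<omega> a x *\<^sub>R b"
      unfolding * eq formula by (simp add: algebra_simps)
    finally show ?thesis .
  qed
  have indep: "x1 *\<^sub>R e + x2 *\<^sub>R f = 0 \<Longrightarrow> x1 = 0 \<and> x2 = 0" for x1 x2
  proof -
    assume 0: "x1 *\<^sub>R e + x2 *\<^sub>R f = 0"
    have "\<omega> e f \<noteq> 0"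
    proof
      assume "\<omega> e f = 0"
      then have "\<omega> e y = 0" for y
        using span[of y] formula[of 1 0] by auto
      then have "e = 0"
        using nd by blast
      then show False using S(1) ef dependent_zero by blast
    qed
    then show ?thesis
      using formula[of x1 x2 0 1] formula[of x1 x2 1 0] unfolding 0 by (simp add: expand)
  qed
  let ?L = "\<lambda>z :: real \<times> real. fst z *\<^sub>R e + snd z *\<^sub>R f"
  have "\<exists>z0 \<in> sphere 0 1. \<forall>z \<in> sphere 0 1. norm (?L z0) \<le> norm (?L z)"
  proof (rule continuous_attains_inf)
    show "sphere (0 :: real \<times> real) 1 \<noteq> {}"
      by (auto intro!: exI[of _ "(1, 0)"])
  qed (auto intro!: continuous_intros)
  then obtain z0 where "z0 \<in> sphere 0 1" "\<forall>z \<in> sphere 0 1. norm (?L z0) \<le> norm (?L z)"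
    by blast
  then have z0: "norm z0 = 1" "\<And>z. norm z = 1 \<Longrightarrow> norm (?L z0) \<le> norm (?L z)"
    by simp_all
  define m where "m = norm (?L z0)"
  have "m > 0"
    unfolding m_def using indep[of "fst z0" "snd z0"] z0(1) by (auto simp: norm_prod_def)
  have L: "m * norm z \<le> norm (?L z)" for z
  proof (cases "z = 0")
    case False
    have "?L z = norm z *\<^sub>R ?L ((1 / norm z) *\<^sub>R z)"
      using False by (simp add: algebra_simps)
    then have eq: "norm (?L z) = norm z * norm (?L ((1 / norm z) *\<^sub>R z))"
      by (metis abs_norm_cancel norm_scaleR)
    have le: "m \<le> norm (?L ((1 / norm z) *\<^sub>R z))"
      unfolding m_def by (rule z0) (use False in simp)
    have "m * norm z = norm z * m"
      by (rule mult.commute)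
    also have "\<dots> \<le> norm z * norm (?L ((1 / norm z) *\<^sub>R z))"
      by (rule mult_left_mono[OF le norm_ge_zero])
    finally show ?thesis
      unfolding eq .
  qed simp
  \<comment> \<open>Each coordinate of \<open>x\<close> is at most \<open>norm x / m\<close>, and
    the determinant in \<open>formula\<close> consists of two products: hence the factor 2 and the
    square of \<open>m\<close>.\<close>
  define K where "K = 2 * \<bar>\<omega> e f\<bar> / m\<^sup>2"
  have bound: "norm (\<omega> a b) \<le> norm a * norm b * K" for a b
  proof -
    obtain a1 a2 b1 b2 where eq: "a = a1 *\<^sub>R e + a2 *\<^sub>R f" "b = b1 *\<^sub>R e + b2 *\<^sub>R f"
      using span[of a] span[of b] by blast
    have c: "\<bar>x1\<bar> \<le> norm x / m" "\<bar>x2\<bar> \<le> norm x / m" if "x = x1 *\<^sub>R e + x2 *\<^sub>R f" for x x1 x2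
    proof -
      have "norm (x1, x2) \<le> norm x / m"
        using L[of "(x1, x2)"] \<open>m > 0\<close> that by (simp add: field_simps)
      then show "\<bar>x1\<bar> \<le> norm x / m" "\<bar>x2\<bar> \<le> norm x / m"
        using norm_fst_le[of x1 x2] norm_snd_le[of x2 x1] by auto
    qed
    have "\<bar>a1 * b2 - a2 * b1\<bar> \<le> \<bar>a1\<bar> * \<bar>b2\<bar> + \<bar>a2\<bar> * \<bar>b1\<bar>"
      by (metis abs_mult abs_triangle_ineq4)
    also have "\<dots> \<le> (norm a / m) * (norm b / m) + (norm a / m) * (norm b / m)"
      using c[OF eq(1)] c[OF eq(2)] \<open>m > 0\<close> by (intro add_mono mult_mono) auto
    finally have "norm (\<omega> a b) \<le> ((norm a / m) * (norm b / m) + (norm a / m) * (norm b / m)) * \<bar>\<omega> e f\<bar>"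
      unfolding eq formula real_norm_def abs_mult[of _ "\<omega> e f"] by (rule mult_right_mono) simp
    also have "\<dots> = norm a * norm b * K"
      unfolding K_def by (simp add: power2_eq_square field_simps)
    finally show ?thesis .
  qed
  show ?thesis
  proof
    show "\<exists>K. \<forall>a b. norm (\<omega> a b) \<le> norm a * norm b * K"
      using bound by blast
    show "\<omega> a b *\<^sub>R x = \<omega> x b *\<^sub>R a + \<omega> a x *\<^sub>R b" for a b x
      by (rule expansion)
    show "x \<noteq> 0 \<Longrightarrow> \<exists>z. \<omega> x z \<noteq> 0" for x
      using nd by blast
  qed (simp_all add: expand alt)
qed

locale smooth_unit_circle = symplectic_plane B
  for B :: "'a::real_normed_vector \<Rightarrow> 'a \<Rightarrow> real" +
  fixes \<phi> \<phi>' :: "real \<Rightarrow> 'a"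
  assumes deriv_\<phi>: "(\<phi> has_vector_derivative \<phi>' t) (at t)"
    and continuous_\<phi>': "continuous_on UNIV \<phi>'"
    and norm_\<phi>': "norm (\<phi>' t) = 1"
    and range_\<phi>: "range \<phi> = sphere 0 1"
begin

lemma norm_\<phi> [simp]: "norm (\<phi> t) = 1"
  using range_\<phi> by auto

lemma first_order:
  assumes "e > 0"
  obtains d where "d > 0" "\<And>x. \<bar>x\<bar> < d \<Longrightarrow> norm (\<phi> (t + x) - (\<phi> t + x *\<^sub>R \<phi>' t)) \<le> e * \<bar>x\<bar>"
proof -
  have "\<exists>d>0. \<forall>y. norm (y - t) < d \<longrightarrow> norm (\<phi> y - \<phi> t - (y - t) *\<^sub>R \<phi>' t) \<le> e * norm (y - t)"
    using deriv_\<phi>[of t] assms unfolding has_vector_derivative_def has_derivative_at_alt by blast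
  then obtain d where d: "d > 0"
    "\<And>y. norm (y - t) < d \<Longrightarrow> norm (\<phi> y - \<phi> t - (y - t) *\<^sub>R \<phi>' t) \<le> e * norm (y - t)"
    by blast
  show thesis
    by (rule that[OF d(1)]) (use d(2)[of "t + _"] in \<open>simp add: diff_diff_eq\<close>)
qed

text \<open>By \<open>anti_norm_\<phi>'\<close> its modulus is the anti-norm of the unit tangent;
  its sign is the orientation of \<open>\<phi>\<close> with respect to \<open>B\<close>.\<close>

definition m :: "real \<Rightarrow> real" where "m t = B (\<phi> t) (\<phi>' t)"

text \<open>If the tangent were radial, it would be \<open>\<phi> t\<close> up to sign. A step of
  length \<open>d / 2\<close> along it in the outward direction would have norm
  \<open>1 + d / 2\<close>, but it has to be within \<open>d / 4\<close> of the unit circle.\<close>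

lemma m_nonzero: "m t \<noteq> 0"
proof
  assume "m t = 0"
  obtain z where z: "B (\<phi> t) z \<noteq> 0"
    using nondegenerate[of "\<phi> t"] norm_\<phi>[of t] by fastforce
  define c where "c = B (\<phi>' t) z / B (\<phi> t) z"
  have c: "\<phi>' t = c *\<^sub>R \<phi> t"
    using coordinates[OF z, of "\<phi>' t"] \<open>m t = 0\<close> by (simp add: c_def m_def)
  then have "\<bar>c\<bar> = 1"
    using norm_\<phi>'[of t] by simp
  then have cc: "c * c = 1"
    by (metis abs_mult_self_eq mult_1)
  obtain d where d: "d > 0" "\<And>x. \<bar>x\<bar> < d \<Longrightarrow> norm (\<phi> (t + x) - (\<phi> t + x *\<^sub>R \<phi>' t)) \<le> 1 / 2 * \<bar>x\<bar>"
    by (rule first_order[of "1/2" t]) auto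
  define x where "x = c * (d / 2)"
  have x: "\<bar>x\<bar> = d / 2"
    using d(1) \<open>\<bar>c\<bar> = 1\<close> by (simp add: x_def abs_mult)
  have "\<phi> t + x *\<^sub>R \<phi>' t = (1 + c * c * (d / 2)) *\<^sub>R \<phi> t"
    unfolding c x_def by (simp add: algebra_simps)
  then have "norm (\<phi> t + x *\<^sub>R \<phi>' t) = 1 + d / 2"
    using d(1) by (simp add: cc)
  moreover have "norm (\<phi> t + x *\<^sub>R \<phi>' t) \<le> norm (\<phi> (t + x)) + 1 / 2 * \<bar>x\<bar>"
    using d(2)[of x] norm_triangle_sub[of "\<phi> t + x *\<^sub>R \<phi>' t" "\<phi> (t + x)"] x d(1)
    by (simp add: norm_minus_commute)
  ultimately show False
    using x d(1) by simp
qed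

lemma coordinates_\<phi>: "x = (B x (\<phi>' t) / m t) *\<^sub>R \<phi> t + (B (\<phi> t) x / m t) *\<^sub>R \<phi>' t"
  using coordinates[of "\<phi> t" "\<phi>' t"] m_nonzero[of t] unfolding m_def by blast

text \<open>A point \<open>y\<close> of the unit ball beyond the tangent line would pull nearby
  points of that line into the ball: a convex combination of \<open>\<phi> t\<close> and
  \<open>y / \<alpha>\<close> lies on the line, and its norm falls short of 1 by an amount linear in
  the weight \<open>l\<close>. The circle leaves its tangent line only by a smaller order.\<close>

lemma support_aux:
  assumes "norm y \<le> 1"
  shows "B y (\<phi>' t) / m t \<le> 1"
proof (rule ccontr)
  define \<alpha> \<beta> where "\<alpha> = B y (\<phi>' t) / m t" and "\<beta> = B (\<phi> t) y / m t"
  assume "\<not> ?thesis"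
  then have \<alpha>: "\<alpha> > 1" by (simp add: \<alpha>_def)
  have y: "y = \<alpha> *\<^sub>R \<phi> t + \<beta> *\<^sub>R \<phi>' t"
    unfolding \<alpha>_def \<beta>_def by (rule coordinates_\<phi>)
  define b where "b = \<beta> / \<alpha>"
  \<comment> \<open>Chosen so that \<open>e * \<bar>b\<bar>\<close> is at most half of the gap
    \<open>1 - 1 / \<alpha>\<close>.\<close>
  define e where "e = (1 - 1 / \<alpha>) / (2 * (\<bar>b\<bar> + 1))"
  have "e > 0"
    using \<alpha> unfolding e_def by (intro divide_pos_pos) auto
  then obtain d where d: "d > 0" "\<And>x. \<bar>x\<bar> < d \<Longrightarrow> norm (\<phi> (t + x) - (\<phi> t + x *\<^sub>R \<phi>' t)) \<le> e * \<bar>x\<bar>"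
    using first_order by metis
  define l where "l = min 1 (d / (2 * (\<bar>b\<bar> + 1)))"
  have l: "0 < l" "l \<le> 1"
    using d(1) by (auto simp: l_def)
  have "l * (\<bar>b\<bar> + 1) \<le> d / (2 * (\<bar>b\<bar> + 1)) * (\<bar>b\<bar> + 1)"
    by (intro mult_right_mono) (auto simp: l_def)
  also have "\<dots> = d / 2"
    using abs_ge_zero[of b] by (simp add: field_simps del: abs_ge_zero)
  finally have "\<bar>l * b\<bar> < d"
    using l d(1) by (simp add: abs_mult distrib_left)
  from d(2)[OF this] have "1 \<le> norm (\<phi> t + (l * b) *\<^sub>R \<phi>' t) + e * \<bar>l * b\<bar>"
    using norm_triangle_sub[of "\<phi> (t + l * b)" "\<phi> t + (l * b) *\<^sub>R \<phi>' t"] by simp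
  also have "\<phi> t + (l * b) *\<^sub>R \<phi>' t = (1 - l) *\<^sub>R \<phi> t + (l / \<alpha>) *\<^sub>R y"
    using \<alpha> by (simp add: y b_def algebra_simps)
  also have "norm \<dots> \<le> (1 - l) + l / \<alpha>"
  proof (rule order_trans[OF norm_triangle_ineq])
    have "l / \<alpha> * norm y \<le> l / \<alpha> * 1"
      using l \<alpha> assms by (intro mult_left_mono) auto
    then show "norm ((1 - l) *\<^sub>R \<phi> t) + norm ((l / \<alpha>) *\<^sub>R y) \<le> (1 - l) + l / \<alpha>"
      using l \<alpha> by simp
  qed
  finally have "l * (1 - 1 / \<alpha>) \<le> l * (e * \<bar>b\<bar>)"
    using l by (simp add: abs_mult algebra_simps)
  then have "1 - 1 / \<alpha> \<le> e * \<bar>b\<bar>"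
    using l by simp
  also have "\<dots> \<le> e * (2 * (\<bar>b\<bar> + 1)) / 2"
    using \<open>e > 0\<close> by simp
  also have "e * (2 * (\<bar>b\<bar> + 1)) = 1 - 1 / \<alpha>"
    unfolding e_def using abs_ge_zero[of b] by (simp del: abs_ge_zero)
  finally show False
    using \<alpha> by (simp add: field_simps)
qed

lemma support: "\<bar>B y (\<phi>' t)\<bar> \<le> \<bar>m t\<bar> * norm y"
proof (cases "y = 0")
  case False
  let ?u = "(1 / norm y) *\<^sub>R y"
  have "B ?u (\<phi>' t) / m t \<le> 1" "B (- ?u) (\<phi>' t) / m t \<le> 1"
    using False by (intro support_aux; simp)+
  then have "\<bar>B y (\<phi>' t) / m t / norm y\<bar> \<le> 1"
    by (simp add: scaleR_left minus_left abs_le_iff field_simps)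
  then show ?thesis
    using False m_nonzero[of t] by (simp add: abs_mult field_simps)
qed (simp add: zero_left)

text \<open>The supremum is attained at \<open>\<phi> t\<close> or at its opposite, because the
  tangent lines there support the ball.\<close>

lemma anti_norm_\<phi>':
  assumes "c \<ge> 0"
  shows "anti_norm B (c *\<^sub>R \<phi>' t) = c * \<bar>m t\<bar>"
  unfolding anti_norm_def
proof (rule cSup_eq_maximum)
  have "B (c *\<^sub>R \<phi>' t) (sgn (- m t) *\<^sub>R \<phi> t) = c * \<bar>m t\<bar>"
    using antisymmetric[of "\<phi>' t" "\<phi> t"]
    by (simp add: scaleR_right scaleR_left minus_right m_def abs_sgn mult.commute sgn_minus)
  moreover have "sgn (- m t) *\<^sub>R \<phi> t \<in> sphere 0 1"
    using m_nonzero[of t] by (simp add: sgn_real_def)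
  ultimately show "c * \<bar>m t\<bar> \<in> B (c *\<^sub>R \<phi>' t) ` sphere 0 1"
    by (metis imageI)
next
  fix x assume "x \<in> B (c *\<^sub>R \<phi>' t) ` sphere 0 1"
  then obtain y where y: "norm y = 1" "x = c * B (\<phi>' t) y" by (auto simp: scaleR_left)
  then have "B (\<phi>' t) y \<le> \<bar>m t\<bar>"
    using support[of y t] antisymmetric[of "\<phi>' t" y] by auto
  then show "x \<le> c * \<bar>m t\<bar>"
    unfolding y using assms by (rule mult_left_mono)
qed

text \<open>The derivative at \<open>y = c *\<^sub>R \<phi> t\<close> is the support functional of
  the tangent line at \<open>\<phi> t\<close>. Support bounds \<open>norm (y + h)\<close> from below
  by \<open>c + f h\<close>; the bound from above holds since \<open>y + h\<close> is a multiple of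
  a point of the tangent line, which is close to the circle.\<close>

lemma norm_has_derivative:
  fixes y :: 'a
  assumes "y \<noteq> 0"
  obtains f where "(norm has_derivative f) (at y)" "f y = norm y" "\<And>h. \<bar>f h\<bar> \<le> norm h"
proof -
  define c where "c = norm y"
  have "c > 0" using assms by (simp add: c_def)
  have "(1 / c) *\<^sub>R y \<in> range \<phi>"
    using \<open>c > 0\<close> unfolding range_\<phi> by (simp add: c_def)
  then obtain t where "(1 / c) *\<^sub>R y = \<phi> t" by blast
  then have t: "y = c *\<^sub>R \<phi> t"
    using \<open>c > 0\<close> by (auto dest: arg_cong[where f = "\<lambda>z. c *\<^sub>R z"])
  define f b where "f = (\<lambda>h. B h (\<phi>' t) / m t)" and "b = (\<lambda>h. B (\<phi> t) h / m t)"
  have f_le: "\<bar>f h\<bar> \<le> norm h" for h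
    using support[of h t] m_nonzero[of t] by (simp add: f_def field_simps)
  have f_y: "f y = c"
    using m_nonzero[of t] by (simp add: f_def t scaleR_left m_def)
  have bl: "bounded_linear f"
    unfolding f_def divide_inverse
    by (intro bounded_linear_mult_left[THEN bounded_linear_compose] bounded_linear_left)
  have "bounded_linear b"
    unfolding b_def divide_inverse
    by (intro bounded_linear_mult_left[THEN bounded_linear_compose] bounded_linear_right)
  from bounded_linear.pos_bounded[OF this]
  obtain K where K: "K > 0" "\<And>h. \<bar>b h\<bar> \<le> norm h * K"
    unfolding real_norm_def by blast
  have "\<exists>d>0. \<forall>z. norm (z - y) < d \<longrightarrow> norm (norm z - norm y - f (z - y)) \<le> e * norm (z - y)"
    if "e > 0" for e
  proof -
    have "e / K > 0" using K that by simp
    then obtain d where d: "d > 0"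
      "\<And>x. \<bar>x\<bar> < d \<Longrightarrow> norm (\<phi> (t + x) - (\<phi> t + x *\<^sub>R \<phi>' t)) \<le> e / K * \<bar>x\<bar>"
      using first_order by metis
    \<comment> \<open>The first bound keeps the scaling factor \<open>s\<close> above
      \<open>c / 2\<close>, the second then keeps the parameter \<open>x\<close> below
      \<open>d\<close>.\<close>
    define r where "r = min (c / 2) (d * c / (2 * K))"
    have "norm (norm (y + h) - norm y - f h) \<le> e * norm h" if h: "norm h < r" for h
    proof -
      define s where "s = c + f h"
      have s: "s > c / 2"
        using f_le[of h] h by (simp add: s_def r_def abs_le_iff)
      define x where "x = b h / s"
      have "\<bar>b h\<bar> < d * (c / 2)"
        using K(2)[of h] h mult_strict_right_mono[of "norm h" "d * c / (2 * K)" K] K(1) by (simp add: r_def)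
      also have "\<dots> \<le> d * s"
        using s d(1) by simp
      finally have x: "\<bar>x\<bar> < d"
        using s \<open>c > 0\<close> by (simp add: x_def field_simps)
      have "y + h = s *\<^sub>R (\<phi> t + x *\<^sub>R \<phi>' t)"
      proof -
        have h_eq: "h = f h *\<^sub>R \<phi> t + b h *\<^sub>R \<phi>' t"
          unfolding f_def b_def by (rule coordinates_\<phi>)
        have "s *\<^sub>R (\<phi> t + x *\<^sub>R \<phi>' t) = c *\<^sub>R \<phi> t + (f h *\<^sub>R \<phi> t + b h *\<^sub>R \<phi>' t)"
        proof -
          have "s *\<^sub>R (\<phi> t + x *\<^sub>R \<phi>' t) = s *\<^sub>R \<phi> t + (s * x) *\<^sub>R \<phi>' t"
            by (simp add: scaleR_add_right)
          moreover have "s * x = b h"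
            using s \<open>c > 0\<close> by (simp add: x_def)
          ultimately show ?thesis
            by (simp add: s_def algebra_simps)
        qed
        then show ?thesis
          using h_eq t by simp
      qed
      then have "norm (y + h) = s * norm (\<phi> t + x *\<^sub>R \<phi>' t)"
        using s \<open>c > 0\<close> by simp
      also have "\<dots> \<le> s * (1 + e / K * \<bar>x\<bar>)"
        using d(2)[OF x] norm_triangle_sub[of "\<phi> t + x *\<^sub>R \<phi>' t" "\<phi> (t + x)"] s \<open>c > 0\<close>
        by (intro mult_left_mono) (auto simp: norm_minus_commute)
      also have "\<dots> = s + e / K * \<bar>b h\<bar>"
        using s \<open>c > 0\<close> by (simp add: x_def distrib_left)
      also have "e / K * \<bar>b h\<bar> \<le> e / K * (norm h * K)"
        using K that \<open>e / K > 0\<close> by (intro mult_left_mono) auto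
      finally have "norm (y + h) \<le> s + e * norm h"
        using K by simp
      moreover have "s \<le> norm (y + h)"
        using f_le[of "y + h"] bounded_linear.linear[OF bl] f_y
        by (simp add: linear_add s_def)
      ultimately show ?thesis
        by (simp add: s_def c_def)
    qed
    then have "\<forall>z. norm (z - y) < r \<longrightarrow> norm (norm z - norm y - f (z - y)) \<le> e * norm (z - y)"
      by (metis add.commute diff_add_cancel)
    moreover have "r > 0"
      using K d(1) \<open>c > 0\<close> by (simp add: r_def)
    ultimately show ?thesis by blast
  qed
  then have "(norm has_derivative f) (at y)"
    unfolding has_derivative_at_alt using bl by blast
  then show thesis
    using that f_y f_le unfolding c_def by blast
qed

text \<open>By convexity the ball contains the segment from \<open>\<phi> t\<close> to
  \<open>y\<close> on the supporting line. Let \<open>a x\<close> and \<open>b x\<close> be the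
  coordinates of \<open>\<phi> x\<close> in the frame at \<open>t\<close>. If
  \<open>a x < 1\<close>, then \<open>\<phi> x\<close> is \<open>a x\<close> times a point of that
  segment plus a tangential vector shorter than \<open>1 - a x\<close>, so its norm is below 1.
  Hence \<open>\<phi>\<close> runs along the segment, and \<open>b' x > 0\<close> fixes the
  direction.\<close>

lemma segment_in_circle:
  assumes y: "norm y = 1" "B y (\<phi>' t) = m t" "y \<noteq> \<phi> t"
  obtains A C where "A < C" "A \<le> t" "t \<le> C" "\<And>x. A < x \<Longrightarrow> x < C \<Longrightarrow> \<phi>' x = \<phi>' t"
proof -
  define \<beta> where "\<beta> = B (\<phi> t) y / m t"
  define a where "a = (\<lambda>x. B (\<phi> x) (\<phi>' t) / m t)"
  define b where "b = (\<lambda>x. B (\<phi> t) (\<phi> x) / m t)"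
  define b' where "b' = (\<lambda>x. B (\<phi> t) (\<phi>' x) / m t)"
  have y_eq: "y = \<phi> t + \<beta> *\<^sub>R \<phi>' t"
    using coordinates_\<phi>[of y t] y(2) m_nonzero[of t] by (simp add: \<beta>_def)
  with y(3) have "\<beta> \<noteq> 0" by auto
  have at_t: "a t = 1" "b t = 0" "b' t = 1"
    using m_nonzero[of t] by (simp_all add: a_def b_def b'_def m_def)
  have bl: "bounded_linear (\<lambda>z. B z (\<phi>' t) / m t)" "bounded_linear (\<lambda>z. B (\<phi> t) z / m t)"
    unfolding divide_inverse
    by (intro bounded_linear_mult_left[THEN bounded_linear_compose] bounded_linear_right bounded_linear_left)+
  have da: "(a has_real_derivative B (\<phi>' x) (\<phi>' t) / m t) (at x)"
    and db: "(b has_real_derivative b' x) (at x)" for x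
    unfolding a_def b_def b'_def has_real_derivative_iff_has_vector_derivative
    by (intro bounded_linear.has_vector_derivative[OF bl(1)]
        bounded_linear.has_vector_derivative[OF bl(2)] deriv_\<phi>)+
  have "isCont \<phi>' t"
    using continuous_\<phi>' by (simp add: continuous_on_eq_continuous_at)
  then have "isCont b' t"
    unfolding b'_def by (rule bounded_linear.continuous[OF bl(2)])
  moreover have "isCont a t" "isCont b t"
    using da db DERIV_isCont by blast+
  ultimately have lim: "(a \<longlongrightarrow> 1) (at t)" "(b' \<longlongrightarrow> 1) (at t)" "(b \<longlongrightarrow> 0) (at t)"
    by (simp_all add: isCont_def at_t)
  have "\<forall>\<^sub>F x in at t. a x > 0" "\<forall>\<^sub>F x in at t. b' x > 0"
    by (rule order_tendstoD(1)[OF lim(1)], simp, rule order_tendstoD(1)[OF lim(2)], simp)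
  moreover have "\<forall>\<^sub>F x in at t. \<bar>b x\<bar> < min 1 \<bar>\<beta>\<bar>"
    by (rule order_tendstoD(2)[OF tendsto_rabs_zero[OF lim(3)]]) (use \<open>\<beta> \<noteq> 0\<close> in simp)
  ultimately have "\<forall>\<^sub>F x in at t. a x > 0 \<and> b' x > 0 \<and> \<bar>b x\<bar> < min 1 \<bar>\<beta>\<bar>"
    by eventually_elim simp
  then obtain d0 where d0: "d0 > 0"
    "\<And>x. x \<noteq> t \<Longrightarrow> \<bar>x - t\<bar> < d0 \<Longrightarrow> a x > 0 \<and> b' x > 0 \<and> \<bar>b x\<bar> < min 1 \<bar>\<beta>\<bar>"
    unfolding eventually_at dist_real_def by blast
  have "b' t > 0" using at_t by simp
  then obtain d1 d2 where d1: "d1 > 0" "\<And>h. 0 < h \<Longrightarrow> h < d1 \<Longrightarrow> b t < b (t + h)"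
    and d2: "d2 > 0" "\<And>h. 0 < h \<Longrightarrow> h < d2 \<Longrightarrow> b (t - h) < b t"
    using DERIV_pos_inc_right[OF db[of t]] DERIV_pos_inc_left[OF db[of t]] by blast
  define d where "d = min d0 (min d1 d2)"
  \<comment> \<open>The segment leaves \<open>\<phi> t\<close> in the direction given by the sign of
    \<open>\<beta>\<close>, so \<open>t\<close> is one end of the parameter interval.\<close>
  define A C where "A = (if \<beta> > 0 then t else t - d)" and "C = (if \<beta> > 0 then t + d else t)"
  have d: "d > 0" using d0(1) d1(1) d2(1) by (simp add: d_def)
  have range: "a x > 0" "b' x > 0" "\<bar>b x\<bar> < 1" "0 < b x / \<beta>" "b x / \<beta> < 1" if x: "A < x" "x < C" for x
  proof -
    have "x \<noteq> t" "\<bar>x - t\<bar> < d0"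
      using x by (auto simp: A_def C_def d_def split: if_splits)
    note * = d0(2)[OF this]
    then show "a x > 0" "b' x > 0" "\<bar>b x\<bar> < 1" by auto
    show pos: "0 < b x / \<beta>"
    proof (cases "\<beta> > 0")
      case True
      then have "b x > 0"
        using x d1(2)[of "x - t"] at_t by (simp add: A_def C_def d_def)
      then show ?thesis using True by simp
    next
      case False
      then have "b x < 0"
        using x d2(2)[of "t - x"] at_t by (simp add: A_def C_def d_def)
      then show ?thesis using False \<open>\<beta> \<noteq> 0\<close> by (simp add: divide_neg_neg)
    qed
    have "\<bar>b x / \<beta>\<bar> < 1"
      using * \<open>\<beta> \<noteq> 0\<close> by (simp add: field_simps)
    then show "b x / \<beta> < 1" by (rule order.strict_trans1[OF abs_ge_self])
  qed
  have a1: "a x = 1" if x: "A < x" "x < C" for x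
  proof (rule ccontr)
    assume "a x \<noteq> 1"
    moreover have "a x \<le> 1"
      unfolding a_def by (rule support_aux) simp
    ultimately have a: "0 < a x" "a x < 1" using range[OF x] by auto
    define l where "l = b x / \<beta>"
    have l: "0 < l" "l < 1" using range[OF x] by (auto simp: l_def)
    have "\<phi> t + b x *\<^sub>R \<phi>' t = (1 - l) *\<^sub>R \<phi> t + l *\<^sub>R y"
      using \<open>\<beta> \<noteq> 0\<close> by (simp add: y_eq l_def algebra_simps)
    then have "norm (\<phi> t + b x *\<^sub>R \<phi>' t) \<le> (1 - l) + l"
      using norm_triangle_ineq[of "(1 - l) *\<^sub>R \<phi> t" "l *\<^sub>R y"] l y(1) by simp
    then have 1: "norm (a x *\<^sub>R (\<phi> t + b x *\<^sub>R \<phi>' t)) \<le> a x"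
      using a by simp
    have "\<phi> x = a x *\<^sub>R \<phi> t + b x *\<^sub>R \<phi>' t"
      unfolding a_def b_def by (rule coordinates_\<phi>)
    also have "\<dots> = a x *\<^sub>R (\<phi> t + b x *\<^sub>R \<phi>' t) + ((1 - a x) * b x) *\<^sub>R \<phi>' t"
      by (simp add: algebra_simps)
    also have "norm \<dots> \<le> a x + (1 - a x) * \<bar>b x\<bar>"
    proof -
      have "norm (((1 - a x) * b x) *\<^sub>R \<phi>' t) = (1 - a x) * \<bar>b x\<bar>"
        using a norm_\<phi>'[of t] by (simp add: abs_mult)
      then show ?thesis
        using norm_triangle_ineq[of "a x *\<^sub>R (\<phi> t + b x *\<^sub>R \<phi>' t)" "((1 - a x) * b x) *\<^sub>R \<phi>' t"] 1
        by linarith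
    qed
    also have "(1 - a x) * \<bar>b x\<bar> < (1 - a x) * 1"
      using a range[OF x] by (intro mult_strict_left_mono) auto
    finally show False by simp
  qed
  show thesis
  proof
    show "A < C" "A \<le> t" "t \<le> C" using d by (auto simp: A_def C_def)
    fix x assume x: "A < x" "x < C"
    have "(a has_real_derivative 0) (at x)"
      by (rule has_field_derivative_transform_within_open[OF DERIV_const[of 1], where S = "{A<..<C}"])
        (use x a1 in auto)
    then have "B (\<phi>' x) (\<phi>' t) / m t = 0"
      using da DERIV_unique by blast
    then have eq: "\<phi>' x = b' x *\<^sub>R \<phi>' t"
      using coordinates_\<phi>[of "\<phi>' x" t] by (simp only: b'_def scaleR_zero_left add_0_left)
    then have "\<bar>b' x\<bar> = 1"
      using norm_\<phi>'[of x] norm_\<phi>'[of t] by simp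
    with eq range[OF x] show "\<phi>' x = \<phi>' t" by simp
  qed
qed

end

section \<open>Curves of positive circular curvature\<close>

text \<open>Here \<open>\<eta>\<close> is the Gauss map into the unit circle, and
  \<open>deriv_\<eta>\<close> is the Frenet equation defining \<open>k\<close>. The pairing of
  \<open>\<eta>\<close> and \<open>\<gamma>'\<close> equals 1 thanks to arc-length in the anti-norm.
  The facts about the unit circle survive as \<open>support\<close>, \<open>strict_support\<close>
  and \<open>norm_differentiable\<close>.\<close>

locale positively_curved_curve = symplectic_plane B
  for B :: "'a::real_normed_vector \<Rightarrow> 'a \<Rightarrow> real" +
  fixes \<gamma> \<gamma>' \<eta> :: "real \<Rightarrow> 'a" and k k' :: "real \<Rightarrow> real" and p :: real
  assumes deriv_\<gamma>: "(\<gamma> has_vector_derivative \<gamma>' s) (at s)"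
    and continuous_\<gamma>': "continuous_on UNIV \<gamma>'"
    and deriv_\<eta>: "(\<eta> has_vector_derivative k s *\<^sub>R \<gamma>' s) (at s)"
    and deriv_k: "(k has_real_derivative k' s) (at s)"
    and continuous_k': "continuous_on UNIV k'"
    and k_pos: "k s > 0"
    and B_\<eta>_\<gamma>' [simp]: "B (\<eta> s) (\<gamma>' s) = 1"
    and norm_\<eta> [simp]: "norm (\<eta> s) = 1"
    and support: "\<bar>B y (\<gamma>' s)\<bar> \<le> norm y"
    and strict_support: "norm y = 1 \<Longrightarrow> B y (\<gamma>' s) = 1 \<Longrightarrow> y = \<eta> s"
    and norm_differentiable: "y \<noteq> 0 \<Longrightarrow>
      \<exists>f. (norm has_derivative f) (at y) \<and> f y = norm y \<and> (\<forall>h. \<bar>f h\<bar> \<le> norm h)"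
    and p_pos: "p > 0"
    and periodic: "\<gamma> (s + p) = \<gamma> s"
    and inj: "inj_on \<gamma> {0..<p}"

text \<open>A second contact point would give a parameter interval next to \<open>t \<sigma>\<close>
  on which \<open>\<phi>'\<close> is constant, and the strictly increasing lift enters it. A bump
  added to the lift there yields a second lift; both have derivative \<open>t'\<close>, so the bump
  would be constant.\<close>

lemma (in smooth_unit_circle) strictly_convex_at_tangent_lift:
  assumes t: "tangent_lift \<phi> c t" "smooth t" and pos: "\<And>\<sigma>. t' \<sigma> > 0"
    and unique: "\<And>t. tangent_lift \<phi> c t \<Longrightarrow> (\<forall>\<sigma>. (t has_real_derivative t' \<sigma>) (at \<sigma>))"
    and y: "norm y = 1" "B y (\<phi>' (t \<sigma>)) = m (t \<sigma>)"
  shows "y = \<phi> (t \<sigma>)"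
proof (rule ccontr)
  assume "y \<noteq> \<phi> (t \<sigma>)"
  then obtain A C where AC: "A < C" "A \<le> t \<sigma>" "t \<sigma> \<le> C"
    and const: "\<And>x. A < x \<Longrightarrow> x < C \<Longrightarrow> \<phi>' x = \<phi>' (t \<sigma>)"
    using segment_in_circle y by metis
  have dt: "(t has_real_derivative t' s) (at s)" for s
    using unique t(1) by blast
  have incr: "t a < t b" if "a < b" for a b
    by (rule DERIV_pos_imp_increasing[OF that]) (use dt pos in blast)
  have cont: "\<exists>d>0. \<forall>r. \<bar>r - s\<bar> < d \<longrightarrow> \<bar>t r - t s\<bar> < e" if "e > 0" for s e
    using DERIV_isCont[OF dt[of s]] that unfolding continuous_at_eps_delta dist_real_def by blast
  \<comment> \<open>\<open>t \<sigma>\<close> may be an end of the interval; as \<open>t\<close> is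
    strictly increasing, a small move of \<open>\<sigma>\<close> to the appropriate side reaches the
    interior.\<close>
  obtain \<sigma>1 where \<sigma>1: "A < t \<sigma>1" "t \<sigma>1 < C"
  proof (cases "t \<sigma> < C")
    case True
    then obtain d where d: "d > 0" "\<And>r. \<bar>r - \<sigma>\<bar> < d \<Longrightarrow> \<bar>t r - t \<sigma>\<bar> < C - t \<sigma>"
      using cont[of "C - t \<sigma>" \<sigma>] by auto
    show thesis
      by (rule that[of "\<sigma> + d / 2"])
        (use d(1) d(2)[of "\<sigma> + d / 2"] incr[of \<sigma> "\<sigma> + d / 2"] AC in auto)
  next
    case False
    then obtain d where d: "d > 0" "\<And>r. \<bar>r - \<sigma>\<bar> < d \<Longrightarrow> \<bar>t r - t \<sigma>\<bar> < t \<sigma> - A"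
      using cont[of "t \<sigma> - A" \<sigma>] AC by auto
    show thesis
      by (rule that[of "\<sigma> - d / 2"])
        (use d(1) d(2)[of "\<sigma> - d / 2"] incr[of "\<sigma> - d / 2" \<sigma>] AC in auto)
  qed
  \<comment> \<open>Half of the room up to \<open>C\<close>: the other half is left for the
    variation of \<open>t\<close> itself, so that \<open>t + g\<close> stays in the
    interval.\<close>
  define e where "e = (C - t \<sigma>1) / 2"
  have "e > 0" using \<sigma>1 by (simp add: e_def)
  then obtain d where d: "d > 0" "\<And>r. \<bar>r - \<sigma>1\<bar> < d \<Longrightarrow> \<bar>t r - t \<sigma>1\<bar> < min e (t \<sigma>1 - A)"
    using cont[of "min e (t \<sigma>1 - A)" \<sigma>1] \<sigma>1 by auto
  obtain g where g: "smooth g" "\<And>x. 0 \<le> g x" "\<And>x. g x \<le> e"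
    "\<And>x. x \<le> \<sigma>1 - d \<or> \<sigma>1 + d \<le> x \<Longrightarrow> g x = 0"
    "\<And>x. \<sigma>1 - d < x \<Longrightarrow> x < \<sigma>1 + d \<Longrightarrow> g x > 0"
    using smooth_bump[of "\<sigma>1 - d" "\<sigma>1 + d" e] d(1) \<open>e > 0\<close> by auto
  have vd: "vector_derivative \<phi> (at x) = \<phi>' x" for x
    using deriv_\<phi> vector_derivative_at by blast
  have "vector_derivative c (at x) = vector_derivative \<phi> (at (t x + g x))" for x
  proof -
    have "\<phi>' (t x + g x) = \<phi>' (t x)"
    proof (cases "\<bar>x - \<sigma>1\<bar> < d")
      case True
      then have "\<bar>t x - t \<sigma>1\<bar> < min e (t \<sigma>1 - A)" by (rule d(2))
      moreover have "t \<sigma>1 + 2 * e = C" by (simp add: e_def field_simps)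
      ultimately have "A < t x" "t x + e < C"
        by (auto simp: abs_less_iff)
      then show ?thesis
        using const[of "t x + g x"] const[of "t x"] g(2)[of x] g(3)[of x] \<open>e > 0\<close> by simp
    next
      case False
      then have "x \<le> \<sigma>1 - d \<or> \<sigma>1 + d \<le> x" by auto
      then show ?thesis using g(4) by simp
    qed
    then show ?thesis
      using t(1) by (simp add: tangent_lift_def vd)
  qed
  then have "tangent_lift \<phi> c (\<lambda>x. t x + g x)"
    unfolding tangent_lift_def using smooth_add[OF t(2) g(1)] by simp
  from unique[OF this] have "((\<lambda>x. (t x + g x) - t x) has_real_derivative t' x - t' x) (at x)" for x
    by (intro DERIV_diff dt) simp
  then have "\<forall>x. (g has_real_derivative 0) (at x)" by simp
  then have "g \<sigma>1 = g (\<sigma>1 + d)"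
    by (rule DERIV_isconst_all)
  then show False
    using g(4)[of "\<sigma>1 + d"] g(5)[of \<sigma>1] d(1) by simp
qed

text \<open>The curvature is given through a reparametrization \<open>h\<close> by arc-length in the
  norm. Its inverse \<open>g\<close> carries the lift back, \<open>\<eta>\<close> is
  \<open>\<phi>\<close> along the lift \<open>T\<close>, and the chain rule turns the definition of
  curvature into the Frenet equation.\<close>

lemma (in smooth_unit_circle) positively_curved_curve:
  assumes m_pos: "\<And>t. m t > 0"
    and \<gamma>: "smooth_simple_closed \<gamma> p" "arc_length_param (anti_norm B) \<gamma>"
    and curvature: "circular_curvature \<phi> \<gamma> k" and k_pos: "\<And>s. k s > 0"
  obtains \<gamma>' \<eta> k' where "positively_curved_curve B \<gamma> \<gamma>' \<eta> k k' p"
proof -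
  obtain \<gamma>' where \<gamma>': "smooth \<gamma>'" "\<And>s. (\<gamma> has_vector_derivative \<gamma>' s) (at s)"
    using \<gamma>(1) smooth_has_vector_derivative unfolding smooth_simple_closed_def by metis
  have cont: "continuous_on UNIV f" if "smooth f" for f :: "real \<Rightarrow> 'b::real_normed_vector"
    using smooth_has_vector_derivative[OF that]
    by (auto simp: continuous_on_eq_continuous_at intro: has_vector_derivative_continuous)
  obtain h where h: "smooth h" "\<And>\<sigma>. deriv h \<sigma> > 0" "surj h"
    and arc: "circular_curvature_arc \<phi> (\<gamma> \<circ> h) (k \<circ> h)"
    using curvature unfolding circular_curvature_def by blast
  obtain h' where h': "smooth h'" "\<And>\<sigma>. (h has_real_derivative h' \<sigma>) (at \<sigma>)"
    using smooth_has_vector_derivative[OF h(1)]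
    by (auto simp: has_real_derivative_iff_has_vector_derivative)
  have h'_pos: "h' \<sigma> > 0" for \<sigma>
    using h(2)[of \<sigma>] DERIV_imp_deriv[OF h'(2)] by simp
  have "strict_mono h"
    by (rule strict_monoI, rule DERIV_pos_imp_increasing) (use h'(2) h'_pos in blast)+
  then have "inj h" by (rule strict_mono_imp_inj_on)
  define g where "g = inv h"
  have hg: "h (g s) = s" and gh: "g (h \<sigma>) = \<sigma>" for s \<sigma>
    using \<open>inj h\<close> \<open>surj h\<close> by (simp_all add: g_def surj_f_inv_f)
  have cont_g: "isCont g s" for s
    using isCont_inverse_function[of 1 "g s" g h] gh hg DERIV_isCont[OF h'(2)] by simp
  have dg: "(g has_real_derivative inverse (h' (g s))) (at s)" for s
    by (rule DERIV_inverse_function[where f = h and a = "s - 1" and b = "s + 1"])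
      (use h'(2) h'_pos[of "g s"] hg cont_g in auto)
  obtain t where t: "tangent_lift \<phi> (\<gamma> \<circ> h) t"
    and unique: "\<And>t. tangent_lift \<phi> (\<gamma> \<circ> h) t \<Longrightarrow> \<forall>\<sigma>. (t has_real_derivative (k \<circ> h) \<sigma>) (at \<sigma>)"
    using arc unfolding circular_curvature_arc_def by blast
  have "smooth t" using t by (simp add: tangent_lift_def)
  then obtain t1 t2 where t12: "smooth t1" "smooth t2"
    "\<And>\<sigma>. (t has_real_derivative t1 \<sigma>) (at \<sigma>)" "\<And>\<sigma>. (t1 has_real_derivative t2 \<sigma>) (at \<sigma>)"
    unfolding has_real_derivative_iff_has_vector_derivative
    using smooth_has_vector_derivative by metis
  have t1: "t1 \<sigma> = k (h \<sigma>)" for \<sigma>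
    using unique[OF t] t12(3) DERIV_unique by fastforce
  have k_eq: "k = (\<lambda>s. t1 (g s))"
    by (simp add: t1 hg)
  define T where "T = (\<lambda>s. t (g s))"
  have \<gamma>'_eq: "\<gamma>' s = inverse (h' (g s)) *\<^sub>R \<phi>' (T s)" for s
  proof -
    have "(\<gamma> \<circ> h has_vector_derivative h' (g s) *\<^sub>R \<gamma>' (h (g s))) (at (g s))"
      by (intro vector_diff_chain_at \<gamma>'(2) h'(2)[unfolded has_real_derivative_iff_has_vector_derivative])
    then have "h' (g s) *\<^sub>R \<gamma>' s = \<phi>' (T s)"
      using t vector_derivative_at[OF deriv_\<phi>] vector_derivative_at
      unfolding tangent_lift_def T_def hg by metis
    then show ?thesis
      using h'_pos[of "g s"] by (metis less_irrefl scaleR_one scaleR_scaleR left_inverse)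
  qed
  \<comment> \<open>The two arc-lengths are compared here: the anti-norm of a tangent vector of unit
    norm is \<open>m (T s)\<close>, so this is the speed of \<open>h\<close>.\<close>
  have h'_eq: "h' (g s) = m (T s)" for s
  proof -
    have "anti_norm B (\<gamma>' s) = 1"
      using \<gamma>(2) vector_derivative_at[OF \<gamma>'(2)] by (simp add: arc_length_param_def)
    then have "inverse (h' (g s)) * m (T s) = 1"
      unfolding \<gamma>'_eq using anti_norm_\<phi>'[of "inverse (h' (g s))" "T s"] h'_pos[of "g s"] m_pos[of "T s"]
      by simp
    then show ?thesis
      using h'_pos[of "g s"] by (simp add: field_simps)
  qed
  have "positively_curved_curve B \<gamma> \<gamma>' (\<lambda>s. \<phi> (T s)) k (\<lambda>s. t2 (g s) * inverse (h' (g s))) p"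
  proof unfold_locales
    fix s
    show "((\<lambda>s. \<phi> (T s)) has_vector_derivative k s *\<^sub>R \<gamma>' s) (at s)"
    proof -
      have "(T has_real_derivative t1 (g s) * inverse (h' (g s))) (at s)"
        unfolding T_def by (rule DERIV_chain2[OF t12(3) dg])
      then have "((\<phi> \<circ> T) has_vector_derivative (t1 (g s) * inverse (h' (g s))) *\<^sub>R \<phi>' (T s)) (at s)"
        by (intro vector_diff_chain_at deriv_\<phi>)
          (simp add: has_real_derivative_iff_has_vector_derivative)
      then show ?thesis
        by (simp add: k_eq \<gamma>'_eq o_def)
    qed
    show "(k has_real_derivative t2 (g s) * inverse (h' (g s))) (at s)"
      unfolding k_eq by (rule DERIV_chain2[OF t12(4) dg])
    show "k s > 0" by (rule k_pos)
    show "B (\<phi> (T s)) (\<gamma>' s) = 1"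
      using m_pos[of "T s"] by (simp add: \<gamma>'_eq scaleR_right h'_eq flip: m_def)
    show "\<bar>B y (\<gamma>' s)\<bar> \<le> norm y" for y
      using support[of y "T s"] m_pos[of "T s"]
      by (simp add: \<gamma>'_eq scaleR_right h'_eq abs_mult field_simps)
    show "y = \<phi> (T s)" if "norm y = 1" "B y (\<gamma>' s) = 1" for y
    proof -
      have "B y (\<phi>' (t (g s))) = m (t (g s))"
        using that(2) m_pos[of "T s"] by (simp add: \<gamma>'_eq scaleR_right h'_eq field_simps T_def)
      note eq = this
      show ?thesis
        unfolding T_def
        by (rule strictly_convex_at_tangent_lift[OF t \<open>smooth t\<close> _ unique that(1) eq])
          (simp_all add: k_pos)
    qed
    show "\<exists>f. (norm has_derivative f) (at y) \<and> f y = norm y \<and> (\<forall>h. \<bar>f h\<bar> \<le> norm h)"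
      if "y \<noteq> 0" for y :: 'a
      by (rule norm_has_derivative[OF that]) blast
    show "continuous_on UNIV \<gamma>'" using cont \<gamma>'(1) by blast
    have g: "continuous_on UNIV g"
      using cont_g by (simp add: continuous_on_eq_continuous_at)
    have "continuous_on UNIV (\<lambda>s. t2 (g s))" "continuous_on UNIV (\<lambda>s. h' (g s))"
      by (rule continuous_on_compose2[OF cont g], rule t12(2) h'(1), rule subset_UNIV)+
    moreover have "\<forall>s\<in>UNIV. h' (g s) \<noteq> 0"
      using h'_pos by (metis less_irrefl)
    ultimately show "continuous_on UNIV (\<lambda>s. t2 (g s) * inverse (h' (g s)))"
      by (intro continuous_on_mult continuous_on_inverse)
    show "p > 0" "\<gamma> (s + p) = \<gamma> s" "inj_on \<gamma> {0..<p}"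
      using \<gamma>(1) by (auto simp: smooth_simple_closed_def)
    show "(\<gamma> has_vector_derivative \<gamma>' s) (at s)" by (rule \<gamma>'(2))
    show "norm (\<phi> (T s)) = 1" by (rule norm_\<phi>)
  qed
  then show thesis by (rule that)
qed

lemma not_inside_if_connected_unbounded:
  assumes "connected C" "\<not> bounded C" "C \<inter> S = {}" "x \<in> C"
  shows "x \<notin> inside S"
proof
  assume "x \<in> inside S"
  then have "bounded (connected_component_set (- S) x)"
    by (simp add: inside_def)
  moreover have "C \<subseteq> connected_component_set (- S) x"
    using assms by (intro connected_component_maximal) auto
  ultimately show False
    using assms(2) bounded_subset by blast
qed

context positively_curved_curve
begin

section \<open>Periodicity, and injectivity modulo the period\<close>

lemma periodic_nat: "\<gamma> (s + real n * p) = \<gamma> s"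
proof (induction n)
  case (Suc n)
  then show ?case
    using periodic[of "s + real n * p"] by (simp add: algebra_simps)
qed simp

lemma periodic_int: "\<gamma> (s + of_int n * p) = \<gamma> s"
proof (cases n)
  case (nonneg m)
  then show ?thesis using periodic_nat[of s m] by simp
next
  case (neg m)
  then have "s + of_int n * p + real (Suc m) * p = s"
    by (simp add: algebra_simps flip: of_nat_Suc)
  from periodic_nat[of "s + of_int n * p" "Suc m", unfolded this]
  show ?thesis by (rule sym)
qed

lemma reduce_period:
  obtains n :: int where "0 \<le> s - of_int n * p" "s - of_int n * p < p"
proof
  show "0 \<le> s - of_int \<lfloor>s / p\<rfloor> * p"
    using floor_divide_lower[OF p_pos, of s] by simp
  show "s - of_int \<lfloor>s / p\<rfloor> * p < p"
    using floor_divide_upper[OF p_pos, of s] by (simp add: algebra_simps)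
qed

lemma image_period: "\<gamma> ` {0..p} = range \<gamma>"
proof
  show "range \<gamma> \<subseteq> \<gamma> ` {0..p}"
  proof
    fix x assume "x \<in> range \<gamma>"
    then obtain s where s: "x = \<gamma> s" by blast
    obtain n where "0 \<le> s - of_int n * p" "s - of_int n * p < p"
      by (rule reduce_period)
    then show "x \<in> \<gamma> ` {0..p}"
      using periodic_int[of "s - of_int n * p" n] s by (intro image_eqI[of _ _ "s - of_int n * p"]) auto
  qed
qed auto

lemma equal_imp_period:
  assumes "\<gamma> a = \<gamma> b"
  obtains n :: int where "a - b = of_int n * p"
proof -
  obtain i where i: "0 \<le> a - of_int i * p" "a - of_int i * p < p"
    by (rule reduce_period)
  obtain j where j: "0 \<le> b - of_int j * p" "b - of_int j * p < p"
    by (rule reduce_period)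
  have "\<gamma> (a - of_int i * p) = \<gamma> (b - of_int j * p)"
    using periodic_int[of "a - of_int i * p" i] periodic_int[of "b - of_int j * p" j] assms by simp
  then have "a - of_int i * p = b - of_int j * p"
    using inj_onD[OF inj] i j by auto
  then have "a - b = of_int (i - j) * p"
    by (simp add: algebra_simps)
  then show thesis by (rule that)
qed

lemma continuous_on_\<gamma>: "continuous_on S \<gamma>"
  by (intro continuous_at_imp_continuous_on ballI has_vector_derivative_continuous[OF deriv_\<gamma>])

lemma continuous_on_\<eta>: "continuous_on S \<eta>"
  by (intro continuous_at_imp_continuous_on ballI has_vector_derivative_continuous[OF deriv_\<eta>])

lemma compact_image: "compact (range \<gamma>)"
  unfolding image_period[symmetric] by (intro compact_continuous_image continuous_on_\<gamma> compact_Icc)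

section \<open>Normals and the distance from a fixed point\<close>

lemma frame: "y = B y (\<gamma>' s) *\<^sub>R \<eta> s + B (\<eta> s) y *\<^sub>R \<gamma>' s"
  using coordinates[of "\<eta> s" "\<gamma>' s" y] by simp

lemma support_eq_imp_normal:
  assumes "\<bar>B y (\<gamma>' s)\<bar> = norm y"
  shows "y = B y (\<gamma>' s) *\<^sub>R \<eta> s"
proof (cases "y = 0")
  case False
  then have nz: "B y (\<gamma>' s) \<noteq> 0" using assms by auto
  let ?u = "(1 / B y (\<gamma>' s)) *\<^sub>R y"
  have "norm ?u = 1"
    using assms nz False by simp
  moreover have "B ?u (\<gamma>' s) = 1"
    using nz by (simp add: scaleR_left)
  ultimately have "?u = \<eta> s" by (rule strict_support)
  moreover have "y = B y (\<gamma>' s) *\<^sub>R ?u"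
    using nz by simp
  ultimately show ?thesis by (simp only:)
qed (simp add: zero_left)

text \<open>In the frame at \<open>s\<close> the norm of \<open>y\<close> splits into
  \<open>\<alpha> * f (\<eta> s)\<close>, which is at most \<open>\<bar>\<alpha>\<bar>\<close> and
  hence at most \<open>norm y\<close>, and \<open>\<beta> * f (\<gamma>' s)\<close>. So the second
  term is nonnegative, and if it vanishes, equality in \<open>support\<close> makes \<open>y\<close>
  normal to the curve.\<close>

lemma norming_functional:
  assumes f: "linear f" "f y = norm y" "\<And>h. \<bar>f h\<bar> \<le> norm h" and "y \<noteq> 0"
  shows "f (\<gamma>' s) = 0 \<Longrightarrow> \<exists>\<rho>. \<bar>\<rho>\<bar> = norm y \<and> y = \<rho> *\<^sub>R \<eta> s"
    and "B (\<eta> s) y \<noteq> 0 \<Longrightarrow> B (\<eta> s) y * f (\<gamma>' s) > 0"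
proof -
  define \<alpha> \<beta> where "\<alpha> = B y (\<gamma>' s)" and "\<beta> = B (\<eta> s) y"
  have y_eq: "y = \<alpha> *\<^sub>R \<eta> s + \<beta> *\<^sub>R \<gamma>' s"
    unfolding \<alpha>_def \<beta>_def by (rule frame)
  have "f y = \<alpha> * f (\<eta> s) + \<beta> * f (\<gamma>' s)"
    by (subst y_eq) (simp add: linear_add[OF f(1)] linear_scale[OF f(1)])
  then have eq: "norm y = \<alpha> * f (\<eta> s) + \<beta> * f (\<gamma>' s)"
    using f(2) by simp
  have "\<alpha> * f (\<eta> s) \<le> \<bar>\<alpha>\<bar> * \<bar>f (\<eta> s)\<bar>"
    by (metis abs_ge_self abs_mult)
  also have "\<dots> \<le> \<bar>\<alpha>\<bar> * 1"
    using f(3)[of "\<eta> s"] by (intro mult_left_mono) auto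
  finally have le: "\<alpha> * f (\<eta> s) \<le> \<bar>\<alpha>\<bar>" by simp
  have \<alpha>_le: "\<bar>\<alpha>\<bar> \<le> norm y"
    unfolding \<alpha>_def by (rule support)
  have normal: "\<bar>\<alpha>\<bar> = norm y \<and> y = \<alpha> *\<^sub>R \<eta> s" if "\<beta> * f (\<gamma>' s) \<le> 0"
  proof -
    have "\<bar>\<alpha>\<bar> = norm y" using eq le \<alpha>_le that by linarith
    then show ?thesis
      using support_eq_imp_normal unfolding \<alpha>_def by blast
  qed
  show "f (\<gamma>' s) = 0 \<Longrightarrow> \<exists>\<rho>. \<bar>\<rho>\<bar> = norm y \<and> y = \<rho> *\<^sub>R \<eta> s"
  proof -
    assume "f (\<gamma>' s) = 0"
    then have "\<beta> * f (\<gamma>' s) \<le> 0" by simp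
    from normal[OF this] show ?thesis by blast
  qed
  show "B (\<eta> s) y * f (\<gamma>' s) > 0" if "B (\<eta> s) y \<noteq> 0"
  proof (rule ccontr)
    assume "\<not> ?thesis"
    then have "\<beta> * f (\<gamma>' s) \<le> 0" by (simp add: \<beta>_def)
    then have "y = \<alpha> *\<^sub>R \<eta> s" using normal by blast
    then have "B (\<eta> s) y = B (\<eta> s) (\<alpha> *\<^sub>R \<eta> s)" by (rule arg_cong)
    then show False using that by (simp add: scaleR_right)
  qed
qed

text \<open>The derivative is that of the norm applied to \<open>\<gamma>' s\<close>. Its zeros are
  the feet of the normals from \<open>x\<close>; elsewhere the growth of the distance is decided by
  the sign of the pairing.\<close>

lemma distance_derivative:
  assumes "\<gamma> s \<noteq> x"
  obtains D where "((\<lambda>s. norm (\<gamma> s - x)) has_real_derivative D) (at s)"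
    "D = 0 \<Longrightarrow> \<exists>\<rho>. \<bar>\<rho>\<bar> = norm (\<gamma> s - x) \<and> \<gamma> s - x = \<rho> *\<^sub>R \<eta> s"
    "B (\<eta> s) (\<gamma> s - x) \<noteq> 0 \<Longrightarrow> B (\<eta> s) (\<gamma> s - x) * D > 0"
proof -
  obtain f where f: "(norm has_derivative f) (at (\<gamma> s - x))" "f (\<gamma> s - x) = norm (\<gamma> s - x)"
    "\<And>h. \<bar>f h\<bar> \<le> norm h"
    using norm_differentiable[of "\<gamma> s - x"] assms by auto
  have lin: "linear f" using has_derivative_linear[OF f(1)] .
  have "((\<lambda>s. \<gamma> s - x) has_derivative (\<lambda>h. h *\<^sub>R \<gamma>' s)) (at s)"
    using has_derivative_diff[OF deriv_\<gamma>[of s, unfolded has_vector_derivative_def] has_derivative_const[of x]]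
    by simp
  from has_derivative_compose[OF this f(1)]
  have "((\<lambda>s. norm (\<gamma> s - x)) has_derivative (\<lambda>h. f (h *\<^sub>R \<gamma>' s))) (at s)" .
  then have "((\<lambda>s. norm (\<gamma> s - x)) has_real_derivative f (\<gamma>' s)) (at s)"
    by (simp add: has_field_derivative_def linear_scale[OF lin] mult_commute_abs)
  then show thesis
  proof (rule that)
    have nz: "\<gamma> s - x \<noteq> 0" using assms by simp
    show "f (\<gamma>' s) = 0 \<Longrightarrow> \<exists>\<rho>. \<bar>\<rho>\<bar> = norm (\<gamma> s - x) \<and> \<gamma> s - x = \<rho> *\<^sub>R \<eta> s"
      by (rule norming_functional(1)[OF lin f(2,3) nz])
    show "B (\<eta> s) (\<gamma> s - x) \<noteq> 0 \<Longrightarrow> B (\<eta> s) (\<gamma> s - x) * f (\<gamma>' s) > 0"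
      by (rule norming_functional(2)[OF lin f(2,3) nz])
  qed
qed

text \<open>At a foot of a normal, where \<open>\<gamma> s - x = \<rho> *\<^sub>R \<eta> s\<close>,
  the pairing vanishes and its derivative is \<open>1 - k s * \<rho>\<close>. This does the work of
  a second derivative of the distance.\<close>

lemma deriv_pairing:
  "((\<lambda>s. B (\<eta> s) (\<gamma> s - x)) has_real_derivative 1 - k s * B (\<gamma> s - x) (\<gamma>' s)) (at s)"
proof -
  have "((\<lambda>s. \<gamma> s - x) has_derivative (\<lambda>h. h *\<^sub>R \<gamma>' s)) (at s)"
    using has_derivative_diff[OF deriv_\<gamma>[of s, unfolded has_vector_derivative_def] has_derivative_const[of x]]
    by simp
  from FDERIV[OF deriv_\<eta>[of s, unfolded has_vector_derivative_def] this]
  have "((\<lambda>s. B (\<eta> s) (\<gamma> s - x)) has_derivative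
      (\<lambda>h. B (\<eta> s) (h *\<^sub>R \<gamma>' s) + B (h *\<^sub>R (k s *\<^sub>R \<gamma>' s)) (\<gamma> s - x))) (at s)" .
  also have "(\<lambda>h. B (\<eta> s) (h *\<^sub>R \<gamma>' s) + B (h *\<^sub>R (k s *\<^sub>R \<gamma>' s)) (\<gamma> s - x)) =
      (*) (1 - k s * B (\<gamma> s - x) (\<gamma>' s))"
    using antisymmetric[of "\<gamma>' s" "\<gamma> s - x"]
    by (simp add: fun_eq_iff scaleR_left scaleR_right algebra_simps)
  finally show ?thesis by (simp add: has_field_derivative_def)
qed

text \<open>The tangents at \<open>s0\<close> agree, and the curvatures decide on which side of the circle about
  \<open>x\<close> the curve continues.\<close>

lemma leaves_circle:
  assumes eq: "\<gamma> s0 - x = \<rho> *\<^sub>R \<eta> s0" and "\<rho> \<noteq> 0" and e: "e * (1 - k s0 * \<rho>) > 0"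
  shows "\<exists>s. e * norm (\<gamma> s - x) > e * norm (\<gamma> s0 - x)"
proof -
  define g where "g = (\<lambda>s. e * B (\<eta> s) (\<gamma> s - x))"
  have "(g has_real_derivative e * (1 - k s0 * \<rho>)) (at s0)"
    unfolding g_def using deriv_pairing[of x s0] by (intro DERIV_cmult) (simp add: eq scaleR_left)
  moreover have "g s0 = 0"
    by (simp add: g_def eq scaleR_right)
  ultimately obtain d1 where d1: "d1 > 0" "\<And>h. 0 < h \<Longrightarrow> h < d1 \<Longrightarrow> g (s0 + h) > 0"
    using DERIV_pos_inc_right[of g "e * (1 - k s0 * \<rho>)" s0] e by metis
  have "\<gamma> s0 \<noteq> x"
    using eq \<open>\<rho> \<noteq> 0\<close> norm_\<eta>[of s0] by (metis diff_self norm_zero scaleR_eq_0_iff zero_neq_one)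
  moreover have "isCont \<gamma> s0"
    using deriv_\<gamma> by (rule has_vector_derivative_continuous)
  ultimately obtain d2 where d2: "d2 > 0" "\<And>s. dist s0 s < d2 \<Longrightarrow> \<gamma> s \<noteq> x"
    using continuous_at_avoid[of s0 \<gamma> x] by blast
  define d where "d = min d1 d2 / 2"
  have d: "0 < d" "d < d1" "d < d2" using d1(1) d2(1) by (auto simp: d_def)
  have "e * norm (\<gamma> s0 - x) < e * norm (\<gamma> (s0 + d) - x)"
  proof (rule DERIV_pos_imp_increasing_open[where f = "\<lambda>s. e * norm (\<gamma> s - x)"])
    fix s assume s: "s0 < s" "s < s0 + d"
    then have "g s > 0"
      using d1(2)[of "s - s0"] d by simp
    then have pos: "e * B (\<eta> s) (\<gamma> s - x) > 0" by (simp add: g_def)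
    have "\<gamma> s \<noteq> x" using d2(2)[of s] s d by (simp add: dist_real_def)
    then obtain D where D: "((\<lambda>s. norm (\<gamma> s - x)) has_real_derivative D) (at s)"
      "B (\<eta> s) (\<gamma> s - x) \<noteq> 0 \<Longrightarrow> B (\<eta> s) (\<gamma> s - x) * D > 0"
      using distance_derivative by metis
    have "B (\<eta> s) (\<gamma> s - x) * D > 0" by (rule D(2)) (use pos in auto)
    then have "e * D > 0"
      using pos by (auto simp: zero_less_mult_iff)
    then show "\<exists>y. ((\<lambda>s. e * norm (\<gamma> s - x)) has_real_derivative y) (at s) \<and> y > 0"
      using DERIV_cmult[OF D(1), of e] by blast
  qed (use d in \<open>auto intro!: continuous_intros continuous_on_\<gamma>\<close>)
  then show ?thesis by blast
qed

text \<open>With \<open>k s0 * \<rho> > 1\<close> the curve would come closer to \<open>x\<close>.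
  Both signs of \<open>\<rho>\<close> are possible: it is negative when \<open>x\<close> lies on the
  side of \<open>\<eta>\<close>.\<close>

lemma nearest_point:
  assumes "\<gamma> s0 \<noteq> x" "\<And>s. norm (\<gamma> s0 - x) \<le> norm (\<gamma> s - x)"
  obtains \<rho> where "\<bar>\<rho>\<bar> = norm (\<gamma> s0 - x)" "\<gamma> s0 - x = \<rho> *\<^sub>R \<eta> s0" "k s0 * \<rho> \<le> 1"
proof -
  obtain D where D: "((\<lambda>s. norm (\<gamma> s - x)) has_real_derivative D) (at s0)"
    "D = 0 \<Longrightarrow> \<exists>\<rho>. \<bar>\<rho>\<bar> = norm (\<gamma> s0 - x) \<and> \<gamma> s0 - x = \<rho> *\<^sub>R \<eta> s0"
    using distance_derivative[OF assms(1)] by metis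
  have "D = 0"
    by (rule DERIV_local_min[OF D(1), of 1]) (use assms(2) in auto)
  then obtain \<rho> where \<rho>: "\<bar>\<rho>\<bar> = norm (\<gamma> s0 - x)" "\<gamma> s0 - x = \<rho> *\<^sub>R \<eta> s0"
    using D(2) by blast
  have "k s0 * \<rho> \<le> 1"
  proof (rule ccontr)
    assume "\<not> ?thesis"
    moreover have "\<rho> \<noteq> 0" using \<rho>(1) assms(1) by auto
    ultimately obtain s where "- 1 * norm (\<gamma> s - x) > - 1 * norm (\<gamma> s0 - x)"
      using leaves_circle[OF \<rho>(2), of "-1"] by auto
    then show False using assms(2)[of s] by simp
  qed
  then show thesis using that \<rho> by blast
qed

text \<open>With \<open>k s0 * \<rho> < 1\<close> the curve would recede from \<open>x\<close>.
  Unlike at a nearest point, the sign is determined: \<open>k s0 * \<rho> \<ge> 1\<close> and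
  positive curvature force \<open>\<rho> > 0\<close>.\<close>

lemma farthest_point:
  assumes "\<gamma> s0 \<noteq> x" "\<And>s. norm (\<gamma> s0 - x) \<ge> norm (\<gamma> s - x)"
  obtains \<rho> where "\<rho> = norm (\<gamma> s0 - x)" "\<gamma> s0 - x = \<rho> *\<^sub>R \<eta> s0" "k s0 * \<rho> \<ge> 1"
proof -
  obtain D where D: "((\<lambda>s. norm (\<gamma> s - x)) has_real_derivative D) (at s0)"
    "D = 0 \<Longrightarrow> \<exists>\<rho>. \<bar>\<rho>\<bar> = norm (\<gamma> s0 - x) \<and> \<gamma> s0 - x = \<rho> *\<^sub>R \<eta> s0"
    using distance_derivative[OF assms(1)] by metis
  have "D = 0"
    by (rule DERIV_local_max[OF D(1), of 1]) (use assms(2) in auto)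
  then obtain \<rho> where \<rho>: "\<bar>\<rho>\<bar> = norm (\<gamma> s0 - x)" "\<gamma> s0 - x = \<rho> *\<^sub>R \<eta> s0"
    using D(2) by blast
  have k: "k s0 * \<rho> \<ge> 1"
  proof (rule ccontr)
    assume "\<not> ?thesis"
    moreover have "\<rho> \<noteq> 0" using \<rho>(1) assms(1) by auto
    ultimately obtain s where "1 * norm (\<gamma> s - x) > 1 * norm (\<gamma> s0 - x)"
      using leaves_circle[OF \<rho>(2), of 1] by auto
    then show False using assms(2)[of s] by simp
  qed
  then have "\<rho> > 0"
    using k_pos[of s0] by (smt (verit) mult_nonneg_nonpos)
  then have "\<rho> = norm (\<gamma> s0 - x)" using \<rho>(1) by linarith
  then show thesis by (rule that[OF _ \<rho>(2) k])
qed

section \<open>The tube along the normals and the outer side\<close>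

lemma periodic_int_\<gamma>': "\<gamma>' (s + of_int n * p) = \<gamma>' s"
proof -
  have "((\<lambda>x. x + of_int n * p) has_vector_derivative 1) (at s)"
    by (auto intro!: derivative_eq_intros)
  then have "(\<gamma> \<circ> (\<lambda>x. x + of_int n * p) has_vector_derivative 1 *\<^sub>R \<gamma>' (s + of_int n * p)) (at s)"
    by (rule vector_diff_chain_at) (rule deriv_\<gamma>)
  moreover have "\<gamma> \<circ> (\<lambda>x. x + of_int n * p) = \<gamma>"
    by (auto simp: periodic_int)
  ultimately show ?thesis
    using vector_derivative_unique_at[OF deriv_\<gamma>[of s]] by fastforce
qed

text \<open>The lift that defines \<open>\<eta>\<close> need not be periodic; periodicity comes from
  \<open>\<eta> s\<close> being determined by \<open>\<gamma>' s\<close>.\<close>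

lemma periodic_int_\<eta>: "\<eta> (s + of_int n * p) = \<eta> s"
proof (rule strict_support)
  show "B (\<eta> (s + of_int n * p)) (\<gamma>' s) = 1"
    using B_\<eta>_\<gamma>'[of "s + of_int n * p"] by (simp add: periodic_int_\<gamma>')
qed simp

text \<open>The pairing is 1 on the diagonal, and uniform continuity on a compact set keeps it
  positive nearby.\<close>

lemma uniform_transversality:
  obtains d where "d > 0" "\<And>s s'. 0 \<le> s \<Longrightarrow> s \<le> p \<Longrightarrow> \<bar>s' - s\<bar> < d \<Longrightarrow> B (\<eta> s) (\<gamma>' s') > 0"
proof -
  \<comment> \<open>The second factor exceeds the period by 1 on both sides, and the final bound is
    cut down to 1, so that \<open>s'\<close> stays within it.\<close>
  let ?K = "{0..p} \<times> {-1..p + 1}"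
  let ?f = "\<lambda>(s, s'). B (\<eta> s) (\<gamma>' s')"
  have "continuous_on ?K (\<lambda>z. B (\<eta> (fst z)) (\<gamma>' (snd z)))"
    by (intro continuous_on continuous_on_compose2[OF continuous_on_\<eta>]
        continuous_on_compose2[OF continuous_\<gamma>'] continuous_intros) auto
  then have "uniformly_continuous_on ?K ?f"
    by (intro compact_uniformly_continuous compact_Times compact_Icc) (simp add: case_prod_unfold)
  then obtain d where d: "d > 0"
    "\<And>z z'. z \<in> ?K \<Longrightarrow> z' \<in> ?K \<Longrightarrow> dist z' z < d \<Longrightarrow> dist (?f z') (?f z) < 1"
    unfolding uniformly_continuous_on_def using zero_less_one by metis
  show thesis
  proof (rule that[of "min d 1"])
    fix s s' assume s: "0 \<le> s" "s \<le> p" "\<bar>s' - s\<bar> < min d 1"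
    have "dist (?f (s, s')) (?f (s, s)) < 1"
      using s by (intro d(2)) (auto simp: dist_Pair_Pair dist_real_def)
    then show "B (\<eta> s) (\<gamma>' s') > 0"
      by (simp add: dist_real_def abs_less_iff)
  qed (use d(1) in simp)
qed

text \<open>For parameters close to \<open>s\<close>, the coordinate \<open>B (\<eta> s)\<close> is
  strictly monotone along the curve, so the normal line at \<open>s\<close> meets this arc only in
  \<open>\<gamma> s\<close>. For parameters away from \<open>s\<close> modulo \<open>p\<close>,
  compactness and injectivity give a positive distance from \<open>\<gamma> s\<close>, and smaller
  \<open>r\<close> cannot bridge it.\<close>

lemma tube:
  obtains d where "d > 0" "\<And>s r s'. r \<noteq> 0 \<Longrightarrow> \<bar>r\<bar> < d \<Longrightarrow> \<gamma> s + r *\<^sub>R \<eta> s \<noteq> \<gamma> s'"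
proof -
  obtain d0 where d0: "d0 > 0"
    "\<And>s s'. 0 \<le> s \<Longrightarrow> s \<le> p \<Longrightarrow> \<bar>s' - s\<bar> < d0 \<Longrightarrow> B (\<eta> s) (\<gamma>' s') > 0"
    using uniform_transversality by blast
  let ?K = "{0..p} \<times> ({-p/2..p/2} - {-d0<..<d0})"
  have "compact ?K"
    by (intro compact_Times compact_Icc compact_diff open_greaterThanLessThan)
  obtain d1 where d1: "d1 > 0" "\<And>z. z \<in> ?K \<Longrightarrow> d1 \<le> norm (\<gamma> (fst z + snd z) - \<gamma> (fst z))"
  proof (cases "?K = {}")
    case True
    show thesis by (rule that[of 1]) (use True in auto)
  next
    case False
    have "continuous_on ?K (\<lambda>z. norm (\<gamma> (fst z + snd z) - \<gamma> (fst z)))"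
      by (intro continuous_intros continuous_on_compose2[OF continuous_on_\<gamma>[of UNIV]]) auto
    from continuous_attains_inf[OF \<open>compact ?K\<close> False this] obtain z where z: "z \<in> ?K"
      "\<And>y. y \<in> ?K \<Longrightarrow> norm (\<gamma> (fst z + snd z) - \<gamma> (fst z)) \<le> norm (\<gamma> (fst y + snd y) - \<gamma> (fst y))"
      by blast
    have "\<gamma> (fst z + snd z) \<noteq> \<gamma> (fst z)"
    proof
      assume "\<gamma> (fst z + snd z) = \<gamma> (fst z)"
      then obtain n :: int where "snd z = of_int n * p"
        by (rule equal_imp_period) auto
      moreover have "\<bar>snd z\<bar> \<le> p / 2" "snd z \<noteq> 0"
        using z(1) d0(1) by (auto simp: mem_Times_iff)
      ultimately have "\<bar>of_int n\<bar> * p \<le> p / 2" "n \<noteq> 0"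
        using p_pos by (auto simp: abs_mult)
      then have "\<bar>real_of_int n\<bar> \<le> 1 / 2" "\<bar>real_of_int n\<bar> \<ge> 1"
        using p_pos by (auto simp: field_simps)
      then show False by simp
    qed
    then show thesis
      using that z(2) by (metis right_minus_eq zero_less_norm_iff)
  qed
  have main: "\<gamma> s + r *\<^sub>R \<eta> s \<noteq> \<gamma> s'" if s: "0 \<le> s" "s < p" and r: "r \<noteq> 0" "\<bar>r\<bar> < d1" for s r s'
  proof
    assume eq: "\<gamma> s + r *\<^sub>R \<eta> s = \<gamma> s'"
    \<comment> \<open>Rounding to the nearest integer brings the parameter difference
      \<open>t\<close> into half a period around 0, where injectivity excludes every return except
      at 0.\<close>
    define n where "n = \<lfloor>(s' - s) / p + 1 / 2\<rfloor>"
    define t where "t = s' - s - of_int n * p"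
    have "of_int n \<le> (s' - s) / p + 1 / 2" "(s' - s) / p + 1 / 2 < of_int n + 1"
      unfolding n_def by linarith+
    then have t: "- p / 2 \<le> t" "t \<le> p / 2"
      unfolding t_def using p_pos by (auto simp: field_simps)
    have "\<gamma> (s + t) = \<gamma> s'"
      using periodic_int[of "s + t" n] by (simp add: t_def)
    then have diff: "\<gamma> (s + t) - \<gamma> s = r *\<^sub>R \<eta> s"
      using eq by (simp add: algebra_simps)
    show False
    proof (cases "\<bar>t\<bar> < d0")
      case False
      then have "(s, t) \<in> ?K" using s t by (auto simp: abs_less_iff)
      from d1(2)[OF this] have "d1 \<le> \<bar>r\<bar>"
        by (simp add: diff)
      then show False using r by simp
    next
      case True
      let ?g = "\<lambda>x. B (\<eta> s) (\<gamma> (s + x))"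
      have d: "(?g has_real_derivative B (\<eta> s) (\<gamma>' (s + x))) (at x)" for x
        unfolding has_real_derivative_iff_has_vector_derivative
      proof (rule bounded_linear.has_vector_derivative[OF bounded_linear_right])
        have "((\<lambda>x. s + x) has_vector_derivative 1) (at x)"
          by (auto intro!: derivative_eq_intros)
        from vector_diff_chain_at[OF this deriv_\<gamma>]
        show "((\<lambda>x. \<gamma> (s + x)) has_vector_derivative \<gamma>' (s + x)) (at x)"
          by (simp add: o_def)
      qed
      have pos: "B (\<eta> s) (\<gamma>' (s + x)) > 0" if "\<bar>x\<bar> \<le> \<bar>t\<bar>" for x
        using d0(2)[of s "s + x"] s that True by simp
      have "?g t - ?g 0 = B (\<eta> s) (\<gamma> (s + t) - \<gamma> s)"
        by (simp add: diff_right)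
      also have "\<dots> = 0"
        unfolding diff by (simp add: scaleR_right)
      finally have "?g t = ?g 0" by simp
      moreover have "?g 0 < ?g t" if "t > 0"
        by (rule DERIV_pos_imp_increasing[OF that]) (use d pos that in force)
      moreover have "?g t < ?g 0" if "t < 0"
        by (rule DERIV_pos_imp_increasing[OF that]) (use d pos that in force)
      ultimately have "t = 0" by linarith
      then have "r *\<^sub>R \<eta> s = 0" using diff by simp
      then show False using r norm_\<eta>[of s] by auto
    qed
  qed
  show thesis
  proof (rule that[OF d1(1)])
    fix s r s' assume r: "r \<noteq> 0" "\<bar>r\<bar> < d1"
    obtain n where n: "0 \<le> s - of_int n * p" "s - of_int n * p < p"
      by (rule reduce_period)
    show "\<gamma> s + r *\<^sub>R \<eta> s \<noteq> \<gamma> s'"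
      using main[OF n r, of s'] periodic_int[of "s - of_int n * p" n] periodic_int_\<eta>[of "s - of_int n * p" n]
      by simp
  qed
qed

text \<open>The side of \<open>\<eta>\<close> is the outer one: it is at a point of the curve farthest from the origin,
  and the one-sided tube around the curve is connected.\<close>

lemma outer_side:
  obtains d where "d > 0" "\<And>s r. 0 < r \<Longrightarrow> r < d \<Longrightarrow> \<gamma> s + r *\<^sub>R \<eta> s \<notin> inside (range \<gamma>)"
proof -
  obtain d where d: "d > 0" "\<And>s r s'. r \<noteq> 0 \<Longrightarrow> \<bar>r\<bar> < d \<Longrightarrow> \<gamma> s + r *\<^sub>R \<eta> s \<noteq> \<gamma> s'"
    using tube by blast
  obtain z where "z \<in> range \<gamma>" and z: "\<And>y. y \<in> range \<gamma> \<Longrightarrow> norm y \<le> norm z"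
    using continuous_attains_sup[OF compact_image _ continuous_on_norm_id] by blast
  then obtain s0 where s0: "\<And>s. norm (\<gamma> s) \<le> norm (\<gamma> s0)" by blast
  have "\<gamma> s0 \<noteq> 0"
  proof
    assume "\<gamma> s0 = 0"
    then have 0: "\<gamma> s = 0" for s using s0[of s] by simp
    have "(0 :: real) = p / 2"
      by (rule inj_onD[OF inj]) (use p_pos 0 in auto)
    then show False using p_pos by simp
  qed
  from farthest_point[of s0 0, unfolded diff_zero, OF this s0]
  obtain \<rho> where \<rho>: "\<rho> = norm (\<gamma> s0)" "\<gamma> s0 = \<rho> *\<^sub>R \<eta> s0"
    by blast
  have "\<rho> > 0" using \<rho>(1) \<open>\<gamma> s0 \<noteq> 0\<close> by simp
  let ?T = "(\<lambda>z. \<gamma> (fst z) + snd z *\<^sub>R \<eta> (fst z)) ` (UNIV \<times> {0<..<d})"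
  \<comment> \<open>The ray from the farthest point away from the origin: its points have norm above
    the maximum \<open>\<rho>\<close>, so it is unbounded and avoids the curve.\<close>
  let ?R = "(\<lambda>t. t *\<^sub>R \<eta> s0) ` {\<rho><..}"
  have "connected ?T"
    by (intro connected_continuous_image convex_connected convex_Times continuous_intros
        continuous_on_compose2[OF continuous_on_\<gamma>[of UNIV]]
        continuous_on_compose2[OF continuous_on_\<eta>[of UNIV]]) auto
  moreover have "connected ?R"
    by (intro connected_continuous_image convex_connected continuous_intros) auto
  moreover have "(\<rho> + d / 2) *\<^sub>R \<eta> s0 \<in> ?T \<inter> ?R"
  proof
    have "(\<rho> + d / 2) *\<^sub>R \<eta> s0 = \<gamma> s0 + (d / 2) *\<^sub>R \<eta> s0"
      using \<rho>(2) by (simp add: scaleR_add_left)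
    then show "(\<rho> + d / 2) *\<^sub>R \<eta> s0 \<in> ?T"
      using d(1) by (intro image_eqI[of _ _ "(s0, d / 2)"]) auto
    show "(\<rho> + d / 2) *\<^sub>R \<eta> s0 \<in> ?R"
      using d(1) by auto
  qed
  ultimately have conn: "connected (?T \<union> ?R)"
    by (intro connected_Un) auto
  have "\<not> bounded ?R"
  proof
    assume "bounded ?R"
    then obtain M where M: "\<And>x. x \<in> ?R \<Longrightarrow> norm x \<le> M" unfolding bounded_iff by blast
    have "norm ((\<bar>M\<bar> + \<rho> + 1) *\<^sub>R \<eta> s0) \<le> M" by (rule M) auto
    then show False using \<open>\<rho> > 0\<close> by simp
  qed
  then have unbdd: "\<not> bounded (?T \<union> ?R)" by simp
  have disj: "(?T \<union> ?R) \<inter> range \<gamma> = {}"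
  proof -
    have "t *\<^sub>R \<eta> s0 \<noteq> \<gamma> s" if "t > \<rho>" for t s
    proof
      assume "t *\<^sub>R \<eta> s0 = \<gamma> s"
      then have "\<bar>t\<bar> = norm (\<gamma> s)" by (metis mult.right_neutral norm_\<eta> norm_scaleR)
      then show False using s0[of s] \<rho>(1) that by simp
    qed
    then have "x \<notin> range \<gamma>" if "x \<in> ?R" for x
      using that by auto
    moreover have "x \<notin> range \<gamma>" if x: "x \<in> ?T" for x
    proof -
      obtain s r where "0 < r" "r < d" "x = \<gamma> s + r *\<^sub>R \<eta> s"
        using x by auto
      then show ?thesis using d(2)[of r s] by auto
    qed
    ultimately show ?thesis by blast
  qed
  show thesis
  proof (rule that[OF d(1)])
    fix s r assume "0 < r" "r < d"
    then have "\<gamma> s + r *\<^sub>R \<eta> s \<in> ?T \<union> ?R"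
      by (intro UnI1 image_eqI[of _ _ "(s, r)"]) auto
    then show "\<gamma> s + r *\<^sub>R \<eta> s \<notin> inside (range \<gamma>)"
      by (rule not_inside_if_connected_unbounded[OF conn unbdd disj])
  qed
qed

text \<open>After \<open>nearest_point\<close> only the sign of \<open>\<rho>\<close> is open. If it
  were negative, follow the segment from \<open>x\<close> towards its nearest point until it enters
  the tube. The points on the way are closer to \<open>x\<close> than the curve is, so this part
  avoids the curve and would join the enclosed point \<open>x\<close> to the outer side.\<close>

lemma inside_covered:
  assumes x: "x \<in> inside (range \<gamma>)"
  obtains s r where "0 \<le> s" "s < p" "0 < r" "x = \<gamma> s - r *\<^sub>R \<eta> s" "k s * r \<le> 1"
    "\<And>\<sigma>. r \<le> norm (\<gamma> \<sigma> - x)"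
proof -
  have "x \<notin> range \<gamma>" using x by (auto simp: inside_def)
  have "continuous_on (range \<gamma>) (\<lambda>y. norm (y - x))" by (intro continuous_intros)
  from continuous_attains_inf[OF compact_image _ this]
  obtain s1 where s1: "\<And>s. norm (\<gamma> s1 - x) \<le> norm (\<gamma> s - x)" by blast
  obtain n where n: "0 \<le> s1 - of_int n * p" "s1 - of_int n * p < p"
    by (rule reduce_period)
  define s0 where "s0 = s1 - of_int n * p"
  have "\<gamma> s0 = \<gamma> s1"
    using periodic_int[of s0 n] by (simp add: s0_def)
  then have s0: "\<And>s. norm (\<gamma> s0 - x) \<le> norm (\<gamma> s - x)" using s1 by simp
  have nz: "\<gamma> s0 \<noteq> x" using \<open>x \<notin> range \<gamma>\<close> by blast
  obtain \<rho> where \<rho>: "\<bar>\<rho>\<bar> = norm (\<gamma> s0 - x)" "\<gamma> s0 - x = \<rho> *\<^sub>R \<eta> s0" "k s0 * \<rho> \<le> 1"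
    using nearest_point[OF nz s0] by metis
  have x_eq: "x = \<gamma> s0 - \<rho> *\<^sub>R \<eta> s0" using \<rho>(2) by (simp add: algebra_simps)
  have "\<rho> > 0"
  proof (rule ccontr)
    assume "\<not> \<rho> > 0"
    moreover have "\<rho> \<noteq> 0" using \<rho>(1) nz by auto
    ultimately have neg: "\<rho> < 0" by simp
    obtain d where d: "d > 0" "\<And>s r. 0 < r \<Longrightarrow> r < d \<Longrightarrow> \<gamma> s + r *\<^sub>R \<eta> s \<notin> inside (range \<gamma>)"
      using outer_side by metis
    \<comment> \<open>The bound \<open>d / 2\<close> puts the end point into the tube, the bound
      \<open>- \<rho>\<close> keeps it on the segment.\<close>
    define r where "r = min (d / 2) (- \<rho>)"
    have r: "0 < r" "r < d" "r \<le> - \<rho>" using d(1) neg by (auto simp: r_def)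
    let ?C = "(\<lambda>t. \<gamma> s0 + t *\<^sub>R \<eta> s0) ` {r..- \<rho>}"
    have "connected ?C"
      by (intro connected_continuous_image connected_Icc continuous_intros)
    moreover have "?C \<subseteq> - range \<gamma>"
    proof -
      have "\<gamma> s0 + t *\<^sub>R \<eta> s0 \<noteq> \<gamma> s" if "r \<le> t" "t \<le> - \<rho>" for t s
      proof
        assume "\<gamma> s0 + t *\<^sub>R \<eta> s0 = \<gamma> s"
        then have "\<gamma> s - x = (t + \<rho>) *\<^sub>R \<eta> s0"
          by (simp add: x_eq algebra_simps flip: \<open>\<gamma> s0 + t *\<^sub>R \<eta> s0 = \<gamma> s\<close>)
        then have "norm (\<gamma> s - x) = \<bar>t + \<rho>\<bar>" by simp
        then show False using s0[of s] \<rho>(1) that r neg by simp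
      qed
      then show ?thesis by fastforce
    qed
    moreover have "x \<in> ?C"
      by (rule image_eqI[of _ _ "- \<rho>"]) (use r x_eq in auto)
    moreover have "\<gamma> s0 + r *\<^sub>R \<eta> s0 \<in> ?C"
      using r by auto
    ultimately have "connected_component (- range \<gamma>) x (\<gamma> s0 + r *\<^sub>R \<eta> s0)"
      unfolding connected_component_def by blast
    then have "\<gamma> s0 + r *\<^sub>R \<eta> s0 \<in> inside (range \<gamma>)"
      using x by (rule inside_same_component)
    then show False using d(2) r by blast
  qed
  show thesis
  proof (rule that)
    show "0 \<le> s0" "s0 < p" using n by (simp_all add: s0_def)
    show "\<rho> \<le> norm (\<gamma> \<sigma> - x)" for \<sigma>
      using s0[of \<sigma>] \<rho>(1) by linarith
  qed (use \<open>\<rho> > 0\<close> x_eq \<rho>(3) in auto)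
qed

end

section \<open>Osculating circles\<close>

context positively_curved_curve
begin

definition radius :: "real \<Rightarrow> real" where "radius s = 1 / k s"
definition radius' :: "real \<Rightarrow> real" where "radius' s = - k' s / (k s)\<^sup>2"

lemma radius_pos: "radius s > 0"
  using k_pos by (simp add: radius_def)

lemma deriv_radius: "(radius has_real_derivative radius' s) (at s)"
  unfolding radius_def radius'_def
  using k_pos[of s] by (auto intro!: derivative_eq_intros deriv_k simp: power2_eq_square)

lemma continuous_on_radius: "continuous_on S radius"
  using deriv_radius DERIV_isCont continuous_at_imp_continuous_on by blast

lemma continuous_radius': "continuous_on UNIV radius'"
proof -
  have "continuous_on UNIV k"
    using deriv_k DERIV_isCont continuous_at_imp_continuous_on by blast
  moreover have "(k s)\<^sup>2 \<noteq> 0" for s using k_pos[of s] by simp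
  ultimately show ?thesis
    unfolding radius'_def by (intro continuous_on_divide continuous_on_minus continuous_k' continuous_on_power) auto
qed

definition evolute :: "real \<Rightarrow> 'a" where "evolute s = \<gamma> s - radius s *\<^sub>R \<eta> s"

lemma deriv_evolute: "(evolute has_vector_derivative - radius' s *\<^sub>R \<eta> s) (at s)"
proof -
  have "(radius has_vector_derivative radius' s) (at s)"
    using deriv_radius by (simp add: has_real_derivative_iff_has_vector_derivative)
  then have "(evolute has_vector_derivative \<gamma>' s - (radius s *\<^sub>R (k s *\<^sub>R \<gamma>' s) + radius' s *\<^sub>R \<eta> s)) (at s)"
    unfolding evolute_def
    by (intro has_vector_derivative_diff deriv_\<gamma> has_vector_derivative_scaleR deriv_\<eta> deriv_radius)
  moreover have "radius s * k s = 1"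
    using k_pos[of s] by (simp add: radius_def)
  ultimately show ?thesis by simp
qed

text \<open>Differentiating \<open>f (\<eta> \<tau>) = 1\<close> gives
  \<open>f (\<gamma>' \<tau>) = 0\<close>, so \<open>f\<close> is the support functional
  \<open>B y (\<gamma>' \<tau>)\<close> for each \<open>\<tau>\<close>. Strict support then makes
  \<open>\<eta>\<close> constant, although its derivative is nonzero. This supplies the strictness
  in \<open>enters_osculating_circle\<close>.\<close>

lemma functional_not_constant_on_normals:
  assumes "a < b" and f: "linear f" "\<And>h. \<bar>f h\<bar> \<le> norm h"
    and f1: "\<And>\<tau>. a < \<tau> \<Longrightarrow> \<tau> < b \<Longrightarrow> f (\<eta> \<tau>) = 1"
  shows False
proof -
  have bl: "bounded_linear f"
    using f by (intro bounded_linear_intro[of f 1]) (auto simp: linear_add linear_scale)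
  have zero: "f (\<gamma>' \<tau>) = 0" if \<tau>: "a < \<tau>" "\<tau> < b" for \<tau>
  proof -
    have "((\<lambda>s. f (\<eta> s)) has_vector_derivative f (k \<tau> *\<^sub>R \<gamma>' \<tau>)) (at \<tau>)"
      by (rule bounded_linear.has_vector_derivative[OF bl deriv_\<eta>])
    moreover have "((\<lambda>s. f (\<eta> s)) has_vector_derivative 0) (at \<tau>)"
      by (rule has_vector_derivative_transform_within_open[where S = "{a<..<b}" and f = "\<lambda>_. 1"])
        (use \<tau> f1 in auto)
    ultimately have "f (k \<tau> *\<^sub>R \<gamma>' \<tau>) = 0"
      by (rule vector_derivative_unique_at)
    then show ?thesis
      using k_pos[of \<tau>] by (simp add: linear_scale[OF f(1)])
  qed
  have f_eq: "f y = B y (\<gamma>' \<tau>)" if "a < \<tau>" "\<tau> < b" for \<tau> y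
  proof -
    have "f y = f (B y (\<gamma>' \<tau>) *\<^sub>R \<eta> \<tau> + B (\<eta> \<tau>) y *\<^sub>R \<gamma>' \<tau>)"
      by (rule arg_cong[OF frame])
    also have "\<dots> = B y (\<gamma>' \<tau>)"
      by (simp add: linear_add[OF f(1)] linear_scale[OF f(1)] zero[OF that] f1[OF that])
    finally show ?thesis .
  qed
  define c where "c = (a + b) / 2"
  have c: "a < c" "c < b" using \<open>a < b\<close> by (auto simp: c_def)
  have const: "\<eta> \<tau> = \<eta> c" if "a < \<tau>" "\<tau> < b" for \<tau>
    by (rule strict_support) (use f_eq[OF c] f1[OF that] in auto)
  have "(\<eta> has_vector_derivative 0) (at c)"
  proof (rule has_vector_derivative_transform_within_open[where S = "{a<..<b}" and f = "\<lambda>_. \<eta> c"])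
    show "\<eta> c = \<eta> \<tau>" if "\<tau> \<in> {a<..<b}" for \<tau>
      by (rule const[symmetric]) (use that in auto)
  qed (use c in auto)
  then have "k c *\<^sub>R \<gamma>' c = 0"
    using deriv_\<eta> vector_derivative_unique_at by blast
  then have "\<gamma>' c = 0" using k_pos[of c] by simp
  then show False using B_\<eta>_\<gamma>'[of c] by (simp add: zero_right)
qed

text \<open>Where the radius of curvature is strictly monotone, the curve enters its osculating circles:
  \<open>\<gamma> \<sigma> - evolute s\<close> is an average of values of \<open>\<eta>\<close>, multiplied by \<open>radius s\<close>.\<close>

lemma enters_osculating_circle:
  assumes "a < b"
    and mono: "(s = a \<and> \<sigma> = b \<and> (\<forall>\<tau>\<in>{a..b}. radius' \<tau> < 0)) \<or> (s = b \<and> \<sigma> = a \<and> (\<forall>\<tau>\<in>{a..b}. radius' \<tau> > 0))"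
  shows "norm (\<gamma> \<sigma> - evolute s) < radius s"
proof (rule ccontr)
  define v where "v = \<gamma> \<sigma> - evolute s"
  assume "\<not> ?thesis"
  then have v: "radius s \<le> norm v" by (simp add: v_def)
  then have "v \<noteq> 0" using radius_pos[of s] by auto
  then obtain f where f: "(norm has_derivative f) (at v)" "f v = norm v" "\<And>h. \<bar>f h\<bar> \<le> norm h"
    using norm_differentiable[of v] by blast
  have lin: "linear f" using has_derivative_linear[OF f(1)] .
  have bl: "bounded_linear f" using has_derivative_bounded_linear[OF f(1)] .
  have f_le: "f (\<eta> \<tau>) \<le> 1" for \<tau>
    using f(3)[of "\<eta> \<tau>"] by simp
  \<comment> \<open>Its derivative has the sign of \<open>radius'\<close> or vanishes, since
    \<open>f\<close> is at most 1 on unit vectors. A point not inside the osculating circle gives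
    \<open>H s \<le> H \<sigma>\<close>, against this monotonicity, so \<open>H\<close> is constant
    and \<open>f (\<eta> \<tau>) = 1\<close> in between.\<close>
  define H where "H = (\<lambda>\<tau>. f (evolute \<tau>) + radius \<tau>)"
  have dH: "(H has_real_derivative radius' \<tau> * (1 - f (\<eta> \<tau>))) (at \<tau>)" for \<tau>
  proof -
    have "((\<lambda>\<tau>. f (evolute \<tau>)) has_real_derivative f (- radius' \<tau> *\<^sub>R \<eta> \<tau>)) (at \<tau>)"
      unfolding has_real_derivative_iff_has_vector_derivative
      by (rule bounded_linear.has_vector_derivative[OF bl deriv_evolute])
    from DERIV_add[OF this deriv_radius[of \<tau>]]
    have "(H has_real_derivative f (- radius' \<tau> *\<^sub>R \<eta> \<tau>) + radius' \<tau>) (at \<tau>)"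
      unfolding H_def .
    moreover have "f (- radius' \<tau> *\<^sub>R \<eta> \<tau>) + radius' \<tau> = radius' \<tau> * (1 - f (\<eta> \<tau>))"
      using linear_scale[OF lin, of "- radius' \<tau>" "\<eta> \<tau>"] by (simp add: algebra_simps)
    ultimately show ?thesis by simp
  qed
  have "v = evolute \<sigma> + radius \<sigma> *\<^sub>R \<eta> \<sigma> - evolute s"
    by (simp add: v_def evolute_def)
  then have "f v = f (evolute \<sigma> + radius \<sigma> *\<^sub>R \<eta> \<sigma> - evolute s)"
    by (rule arg_cong)
  then have "f v = f (evolute \<sigma>) + radius \<sigma> * f (\<eta> \<sigma>) - f (evolute s)"
    by (simp add: linear_add[OF lin] linear_diff[OF lin] linear_scale[OF lin])
  moreover have "radius \<sigma> * f (\<eta> \<sigma>) \<le> radius \<sigma> * 1"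
    using f_le radius_pos[of \<sigma>] by (intro mult_left_mono) auto
  ultimately have H_le: "H s \<le> H \<sigma>"
    using v f(2) by (simp add: H_def)
  have const: "H \<tau> = H a" if "a \<le> \<tau>" "\<tau> \<le> b" for \<tau>
    using mono
  proof (elim disjE conjE)
    assume *: "s = a" "\<sigma> = b" "\<forall>\<tau>\<in>{a..b}. radius' \<tau> < 0"
    have "H y \<le> H x" if "a \<le> x" "x \<le> y" "y \<le> b" for x y
      by (rule DERIV_nonpos_imp_nonincreasing[OF that(2)])
        (use that * f_le in \<open>auto intro!: exI dH simp: mult_le_0_iff less_imp_le\<close>)
    from this[of a \<tau>] this[of \<tau> b] show ?thesis using * H_le that by simp
  next
    assume *: "s = b" "\<sigma> = a" "\<forall>\<tau>\<in>{a..b}. radius' \<tau> > 0"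
    have "H x \<le> H y" if "a \<le> x" "x \<le> y" "y \<le> b" for x y
      by (rule DERIV_nonneg_imp_nondecreasing[OF that(2)])
        (use that * f_le in \<open>auto intro!: exI dH simp: less_imp_le\<close>)
    from this[of a \<tau>] this[of \<tau> b] show ?thesis using * H_le that by simp
  qed
  have "f (\<eta> \<tau>) = 1" if \<tau>: "a < \<tau>" "\<tau> < b" for \<tau>
  proof -
    have "(H has_real_derivative 0) (at \<tau>)"
    proof (rule has_field_derivative_transform_within_open[OF DERIV_const[of "H a"], where S = "{a<..<b}"])
      show "H a = H x" if "x \<in> {a<..<b}" for x
        by (rule const[symmetric]) (use that in auto)
    qed (use \<tau> in auto)
    then have "radius' \<tau> * (1 - f (\<eta> \<tau>)) = 0"
      using dH DERIV_unique by blast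
    moreover have "radius' \<tau> \<noteq> 0" using mono \<tau> by (metis atLeastAtMost_iff less_imp_le less_irrefl)
    ultimately show ?thesis by simp
  qed
  then show False
    by (rule functional_not_constant_on_normals[OF \<open>a < b\<close> lin f(3)])
qed

text \<open>A nonzero \<open>radius'\<close> keeps its sign on an interval. Of its two ends, the one
  with the larger radius has an osculating circle that the other end enters.\<close>

lemma constant_curvature:
  assumes osc: "\<And>s \<sigma>. 0 \<le> s \<Longrightarrow> s \<le> p \<Longrightarrow> radius s \<le> norm (\<gamma> \<sigma> - evolute s)"
    and s: "0 \<le> s" "s \<le> p"
  shows "radius s = radius 0"
proof -
  have zero: "radius' s = 0" if s: "0 < s" "s < p" for s
  proof (rule ccontr)
    assume "radius' s \<noteq> 0"
    have cont: "isCont radius' s"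
      using continuous_radius' by (simp add: continuous_on_eq_continuous_at)
    obtain d where d: "d > 0" "\<And>x. \<bar>x - s\<bar> < d \<Longrightarrow> radius' x * sgn (radius' s) > 0"
    proof -
      have "isCont (\<lambda>x. radius' x * sgn (radius' s)) s"
        using cont by (intro continuous_intros)
      moreover have pos: "radius' s * sgn (radius' s) > 0"
        using \<open>radius' s \<noteq> 0\<close> by (simp flip: abs_sgn)
      ultimately have "\<forall>\<^sub>F x in at s. radius' x * sgn (radius' s) > 0"
        unfolding isCont_def by (rule order_tendstoD(1))
      then obtain d where "d > 0" "\<And>x. x \<noteq> s \<Longrightarrow> \<bar>x - s\<bar> < d \<Longrightarrow> radius' x * sgn (radius' s) > 0"
        unfolding eventually_at dist_real_def by blast
      then show thesis
        using that pos by metis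
    qed
    \<comment> \<open>The bound \<open>d / 2\<close> keeps the sign of \<open>radius'\<close> on
      \<open>{s..s + e}\<close>; \<open>p - s\<close> keeps \<open>s + e\<close> in the period,
      where \<open>osc\<close> applies.\<close>
    define e where "e = min (d / 2) (min s (p - s))"
    have e: "e > 0" "e < d" "e \<le> s" "e \<le> p - s" using d(1) s by (auto simp: e_def)
    show False
    proof (cases "radius' s > 0")
      case True
      have "norm (\<gamma> s - evolute (s + e)) < radius (s + e)"
        by (rule enters_osculating_circle[of s "s + e"])
          (use d(2) e True in \<open>auto simp: zero_less_mult_iff\<close>)
      then show False using osc[of "s + e" s] e s by simp
    next
      case False
      have "norm (\<gamma> (s + e) - evolute s) < radius s"
        by (rule enters_osculating_circle[of s "s + e"])
          (use d(2) e False \<open>radius' s \<noteq> 0\<close> in \<open>auto simp: zero_less_mult_iff sgn_if\<close>)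
      then show False using osc[of s "s + e"] e s by simp
    qed
  qed
  show ?thesis
    by (rule DERIV_isconst2[of 0 p]) (use p_pos s deriv_radius zero continuous_on_radius in \<open>auto, metis\<close>)
qed

text \<open>The centre of curvature is constant, so the curve lies on a sphere. Were a point
  \<open>w\<close> of the sphere missing, the open ball together with the ray from the centre
  through \<open>w\<close> would be connected, unbounded and off the curve; but an enclosed point
  lies in that ball, by the bound on the distance in \<open>inside_covered\<close>.\<close>

lemma circle_if_constant_curvature:
  assumes radius: "\<And>s. 0 \<le> s \<Longrightarrow> s \<le> p \<Longrightarrow> radius s = radius 0" and ne: "inside (range \<gamma>) \<noteq> {}"
  shows "\<exists>a. range \<gamma> = sphere a (radius 0)"
proof -
  have "((\<lambda>s. \<gamma> s - radius 0 *\<^sub>R \<eta> s) has_vector_derivative 0) (at s within {0..p})" if "s \<in> {0..p}" for s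
  proof -
    have "((\<lambda>s. \<gamma> s - radius 0 *\<^sub>R \<eta> s) has_vector_derivative \<gamma>' s - radius 0 *\<^sub>R (k s *\<^sub>R \<gamma>' s)) (at s)"
      by (intro has_vector_derivative_diff deriv_\<gamma> deriv_\<eta>
          bounded_linear.has_vector_derivative[OF bounded_linear_scaleR_right])
    moreover have "radius 0 * k s = 1"
      using radius[of s] that k_pos[of s] by (simp add: radius_def)
    ultimately show ?thesis
      by (simp add: has_vector_derivative_at_within)
  qed
  from has_vector_derivative_zero_constant[OF convex_real_interval(5) this]
  obtain a where "\<And>s. s \<in> {0..p} \<Longrightarrow> \<gamma> s - radius 0 *\<^sub>R \<eta> s = a"
    by blast
  then have a: "\<gamma> s = a + radius 0 *\<^sub>R \<eta> s" if "0 \<le> s" "s \<le> p" for s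
    using that by (simp add: algebra_simps)
  have sub: "range \<gamma> \<subseteq> sphere a (radius 0)"
    unfolding image_period[symmetric] using radius_pos[of 0] by (auto simp: a dist_norm)
  moreover have "w \<in> range \<gamma>" if w: "w \<in> sphere a (radius 0)" for w
  proof (rule ccontr)
    assume "w \<notin> range \<gamma>"
    let ?R = "(\<lambda>t. a + t *\<^sub>R (w - a)) ` {0..}"
    let ?C = "ball a (radius 0) \<union> ?R"
    have nw: "norm (w - a) = radius 0" using w by (simp add: dist_norm norm_minus_commute)
    have "connected ?R"
      by (intro connected_continuous_image convex_connected continuous_intros) auto
    moreover have "a \<in> ball a (radius 0) \<inter> ?R"
    proof
      show "a \<in> ball a (radius 0)" using radius_pos[of 0] by simp
      show "a \<in> ?R" by (rule image_eqI[of _ _ 0]) auto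
    qed
    ultimately have conn: "connected ?C"
      by (intro connected_Un connected_ball) blast+
    have "\<not> bounded ?R"
    proof
      assume "bounded ?R"
      then obtain M where M: "\<And>x. x \<in> ?R \<Longrightarrow> dist a x \<le> M"
        using bounded_any_center[of ?R a] by blast
      have "dist a (a + ((\<bar>M\<bar> + 1) / radius 0) *\<^sub>R (w - a)) \<le> M"
        by (rule M) (use radius_pos[of 0] in auto)
      then show False using nw radius_pos[of 0] by (simp add: dist_norm)
    qed
    then have unbdd: "\<not> bounded ?C" by simp
    have "x \<notin> range \<gamma>" if xR: "x \<in> ?R" for x
    proof
      assume "x \<in> range \<gamma>"
      obtain t where t: "t \<ge> 0" "x = a + t *\<^sub>R (w - a)" using xR by auto
      have "dist a x = radius 0" using sub \<open>x \<in> range \<gamma>\<close> by auto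
      then have "t = 1" using t nw radius_pos[of 0] by (simp add: dist_norm)
      then show False using t \<open>x \<in> range \<gamma>\<close> \<open>w \<notin> range \<gamma>\<close> by simp
    qed
    moreover have "ball a (radius 0) \<inter> range \<gamma> = {}" using sub by auto
    ultimately have disj: "?C \<inter> range \<gamma> = {}" by blast
    obtain x where x: "x \<in> inside (range \<gamma>)" using ne by blast
    obtain s r where sr: "0 \<le> s" "s < p" "0 < r" "x = \<gamma> s - r *\<^sub>R \<eta> s" "k s * r \<le> 1"
      using inside_covered[OF x] by metis
    have "r \<le> radius 0"
      using sr radius[of s] k_pos[of s] by (simp add: radius_def field_simps)
    moreover have "x = a + (radius 0 - r) *\<^sub>R \<eta> s"
      using sr a[of s] by (simp add: algebra_simps)
    ultimately have "x \<in> ?C" using sr(3) by (auto simp: dist_norm)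
    then show False
      using x not_inside_if_connected_unbounded[OF conn unbdd disj] by blast
  qed
  ultimately show ?thesis by blast
qed

text \<open>Each point of the curve is both a nearest and a farthest one from the centre, so
  \<open>k s * r\<close> is bounded by 1 from both sides.\<close>

lemma constant_curvature_if_circle:
  assumes "range \<gamma> = sphere a r" "r > 0"
  shows "radius s = r" "\<gamma> s = a + r *\<^sub>R \<eta> s"
proof -
  have dist: "norm (\<gamma> s - a) = r" for s
    using assms(1) by (metis dist_commute dist_norm mem_sphere rangeI)
  have nz: "\<gamma> s \<noteq> a" using dist[of s] assms(2) by auto
  obtain \<rho>1 where 1: "\<gamma> s - a = \<rho>1 *\<^sub>R \<eta> s" "k s * \<rho>1 \<le> 1"
    using nearest_point[OF nz] dist by (metis order_refl)
  obtain \<rho>2 where 2: "\<rho>2 = r" "\<gamma> s - a = \<rho>2 *\<^sub>R \<eta> s" "k s * \<rho>2 \<ge> 1"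
    using farthest_point[OF nz] dist by (metis order_refl)
  have "\<rho>1 *\<^sub>R \<eta> s = \<rho>2 *\<^sub>R \<eta> s"
    by (rule trans[OF 1(1)[symmetric] 2(2)])
  moreover have "\<eta> s \<noteq> 0" using norm_\<eta>[of s] by (metis norm_zero zero_neq_one)
  ultimately have "\<rho>1 = \<rho>2" by simp
  then have "k s * r = 1" using 1 2 by simp
  then show "radius s = r"
    using k_pos[of s] by (simp add: radius_def field_simps)
  show "\<gamma> s = a + r *\<^sub>R \<eta> s"
    using 2 by (simp add: algebra_simps)
qed

end

section \<open>Area of the image of the normal map\<close>

text \<open>Areas are measured in \<open>real \<times> real\<close>, while Jacobian determinants
  live on \<open>real ^ 2\<close>; this identification lets measures and integrals pass between the
  two.\<close>

lemma distr_lborel_vec_pair: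
  "distr (lborel :: (real ^ 2) measure) borel (\<lambda>z. (z $ 1, z $ 2)) = (lborel :: (real \<times> real) measure)"
proof (rule lborel_eqI[symmetric])
  fix l u :: "real \<times> real"
  assume le: "\<And>b. b \<in> Basis \<Longrightarrow> l \<bullet> b \<le> u \<bullet> b"
  have l: "fst l \<le> fst u" "snd l \<le> snd u"
    using le[of "(1, 0)"] le[of "(0, 1)"] by (auto simp: Basis_prod_def inner_prod_def)
  let ?v = "\<lambda>z :: real \<times> real. vector [fst z, snd z] :: real ^ 2"
  have vimage: "(\<lambda>z :: real ^ 2. (z $ 1, z $ 2)) -` box l u = box (?v l) (?v u)"
    by (auto simp: mem_box_cart forall_2 vector_2 mem_box Basis_prod_def inner_prod_def)
  have meas: "(\<lambda>z :: real ^ 2. (z $ 1, z $ 2)) \<in> borel_measurable borel"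
    by (intro borel_measurable_continuous_onI continuous_intros)
  have "emeasure (distr lborel borel (\<lambda>z :: real ^ 2. (z $ 1, z $ 2))) (box l u) =
      emeasure lborel (box (?v l) (?v u))"
    using meas by (subst emeasure_distr) (simp_all add: vimage)
  also have "\<dots> = ennreal (\<Prod>b\<in>Basis. (?v u - ?v l) \<bullet> b)"
    by (rule emeasure_lborel_box)
      (use l in \<open>auto simp: Basis_vec_def inner_axis UNIV_2 vector_2\<close>)
  also have "(\<Prod>b\<in>Basis. (?v u - ?v l) \<bullet> b) = (\<Prod>b\<in>Basis. (u - l) \<bullet> b)"
  proof -
    have basis: "(Basis :: (real ^ 2) set) = {axis 1 1, axis 2 1}"
      by (auto simp: Basis_vec_def UNIV_2)
    have "axis 1 1 \<noteq> (axis 2 1 :: real ^ 2)"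
      by (simp add: axis_eq_axis)
    then show ?thesis
      unfolding basis by (simp add: inner_axis vector_2 Basis_prod_def inner_prod_def)
  qed
  finally show "emeasure (distr lborel borel (\<lambda>z :: real ^ 2. (z $ 1, z $ 2))) (box l u) =
      ennreal (\<Prod>b\<in>Basis. (u - l) \<bullet> b)" .
qed simp

lemma measurable_vec_pair: "(\<lambda>z :: real ^ 2. (z $ 1, z $ 2)) \<in> lborel \<rightarrow>\<^sub>M borel"
proof -
  have "(\<lambda>z :: real ^ 2. (z $ 1, z $ 2)) \<in> borel \<rightarrow>\<^sub>M borel"
    by (intro borel_measurable_continuous_onI continuous_intros)
  then show ?thesis by simp
qed

lemma measure_vec_pair:
  assumes "open (A :: (real \<times> real) set)"
  shows "measure lebesgue A = measure lebesgue {z :: real ^ 2. (z $ 1, z $ 2) \<in> A}"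
proof -
  have "open {z :: real ^ 2. (z $ 1, z $ 2) \<in> A}"
    using open_vimage[OF assms, of "\<lambda>z :: real ^ 2. (z $ 1, z $ 2)"]
    by (simp add: vimage_def continuous_intros)
  moreover have "measure lborel A = measure (distr lborel borel (\<lambda>z :: real ^ 2. (z $ 1, z $ 2))) A"
    by (simp add: distr_lborel_vec_pair)
  moreover have "\<dots> = measure lborel {z :: real ^ 2. (z $ 1, z $ 2) \<in> A}"
    using assms by (subst measure_distr[OF measurable_vec_pair]) (auto simp: vimage_def)
  ultimately show ?thesis
    using assms by simp
qed

lemma integral_vec_pair:
  fixes f :: "real \<times> real \<Rightarrow> real"
  assumes "continuous_on (cbox (a, c) (b, d)) f"
  shows "integral (cbox (vector [a, c]) (vector [b, d])) (\<lambda>z :: real ^ 2. f (z $ 1, z $ 2)) =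
    integral {a..b} (\<lambda>x. integral {c..d} (\<lambda>y. f (x, y)))"
proof -
  let ?S = "cbox (a, c) (b, d)" and ?S' = "cbox (vector [a, c]) (vector [b, d]) :: (real ^ 2) set"
  let ?pr = "\<lambda>z :: real ^ 2. (z $ 1, z $ 2)"
  have mem: "?pr z \<in> ?S \<longleftrightarrow> z \<in> ?S'" for z
    by (auto simp: mem_box_cart forall_2 vector_2)
  have int: "integrable lborel (\<lambda>x. indicator ?S x *\<^sub>R f x)"
    by (rule borel_integrable_compact[OF compact_cbox assms])
  have "continuous_on ?S' (\<lambda>z. f (?pr z))"
    by (rule continuous_on_compose2[OF assms], intro continuous_intros, rule image_subsetI)
      (simp only: mem)
  then have int': "integrable lborel (\<lambda>x. indicator ?S' x *\<^sub>R f (?pr x))"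
    by (rule borel_integrable_compact[OF compact_cbox])
  have "integral ?S' (\<lambda>z. f (?pr z)) = integral\<^sup>L lborel (\<lambda>z. indicator ?S' z *\<^sub>R f (?pr z))"
    using set_borel_integral_eq_integral(2)[of ?S' "\<lambda>z. f (?pr z)"] int'
    by (simp add: set_integrable_def set_lebesgue_integral_def)
  also have "\<dots> = integral\<^sup>L lborel (\<lambda>z. indicator ?S (?pr z) *\<^sub>R f (?pr z))"
    by (intro Bochner_Integration.integral_cong refl) (simp add: indicator_def mem del: cbox_Pair_iff)
  also have "\<dots> = integral\<^sup>L (distr lborel borel ?pr) (\<lambda>x. indicator ?S x *\<^sub>R f x)"
    using int by (intro integral_distr[symmetric, OF measurable_vec_pair]) auto
  also have "\<dots> = integral ?S f"
    unfolding distr_lborel_vec_pair using set_borel_integral_eq_integral(2)[of ?S f] int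
    by (simp add: set_integrable_def set_lebesgue_integral_def)
  also have "\<dots> = integral {a..b} (\<lambda>x. integral {c..d} (\<lambda>y. f (x, y)))"
    using integral_prod_continuous[OF assms] by simp
  finally show ?thesis .
qed

context symplectic_plane
begin

text \<open>Coordinates with respect to a basis with \<open>B u v\<close> equal to 1 or -1. This
  number is its own inverse, so it replaces the division in Cramer's rule and covers both signs of
  the form.\<close>

definition coord :: "'a \<Rightarrow> 'a \<Rightarrow> 'a \<Rightarrow> real ^ 2" where
  "coord u v x = (B u v * B x v) *\<^sub>R axis 1 1 + (B u v * B u x) *\<^sub>R axis 2 1"

lemma coord_nth [simp]: "coord u v x $ 1 = B u v * B x v" "coord u v x $ 2 = B u v * B u x"
  by (simp_all add: coord_def axis_def)

lemma bounded_linear_coord: "bounded_linear (coord u v)"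
  unfolding coord_def
  by (intro bounded_linear_add bounded_linear_scaleR_left[THEN bounded_linear_compose]
      bounded_linear_mult_right[THEN bounded_linear_compose] bounded_linear_left bounded_linear_right)

lemma coord_combination:
  assumes "\<bar>B u v\<bar> = 1"
  shows "coord u v (z $ 1 *\<^sub>R u + z $ 2 *\<^sub>R v) = z"
proof -
  have "B u v * B u v = 1"
    using assms by (metis abs_mult_self_eq mult_1)
  then show ?thesis
    by (simp add: vec_eq_iff forall_2 add_left add_right scaleR_left scaleR_right algebra_simps)
qed

lemma combination_coord:
  assumes "\<bar>B u v\<bar> = 1"
  shows "coord u v x $ 1 *\<^sub>R u + coord u v x $ 2 *\<^sub>R v = x"
proof -
  have c: "B u v * B u v = 1"
    using assms by (metis abs_mult_self_eq mult_1)
  have "coord u v x $ 1 *\<^sub>R u + coord u v x $ 2 *\<^sub>R v = B u v *\<^sub>R (B x v *\<^sub>R u + B u x *\<^sub>R v)"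
    by (simp add: scaleR_add_right)
  also have "\<dots> = B u v *\<^sub>R (B u v *\<^sub>R x)"
    by (simp only: expansion[of u v x])
  finally show ?thesis using c by simp
qed

text \<open>Lebesgue measure in these coordinates is the area given by \<open>B\<close>: the area
  distortion of a map can be computed by pairing its partial derivatives.\<close>

lemma det_coord:
  assumes "\<bar>B u v\<bar> = 1"
  shows "\<bar>det (matrix (\<lambda>h. coord u v (h $ 1 *\<^sub>R a + h $ 2 *\<^sub>R b)))\<bar> = \<bar>B a b\<bar>"
proof -
  have c: "B u v * B u v = 1"
    using assms by (metis abs_mult_self_eq mult_1)
  have "det (matrix (\<lambda>h. coord u v (h $ 1 *\<^sub>R a + h $ 2 *\<^sub>R b))) =
      (B u v * B u v) * (B a v * B u b - B b v * B u a)"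
    by (simp add: det_2 matrix_def axis_def algebra_simps)
  also have "B a v * B u b - B b v * B u a = B u v * B a b"
  proof -
    have "B (B u v *\<^sub>R a) b = B (B a v *\<^sub>R u + B u a *\<^sub>R v) b"
      by (simp only: expansion[of u v a])
    then have "B u v * B a b = B a v * B u b + B u a * B v b"
      by (simp add: add_left scaleR_left)
    then show ?thesis
      using antisymmetric[of v b] by simp
  qed
  finally show ?thesis
    using assms c by (simp add: abs_mult)
qed

end

context positively_curved_curve
begin

text \<open>The distance along the normal is rescaled by \<open>k\<close>, so that the domain becomes a rectangle.\<close>

definition normal_map :: "real ^ 2 \<Rightarrow> 'a" where
  "normal_map z = \<gamma> (z $ 1) - (z $ 2 * radius (z $ 1)) *\<^sub>R \<eta> (z $ 1)"

definition jacobian :: "real ^ 2 \<Rightarrow> real" where "jacobian z = (1 - z $ 2) * radius (z $ 1)"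

abbreviation rect :: "(real ^ 2) set" where "rect \<equiv> cbox (vector [0, 0]) (vector [p, 1])"

lemma mem_rect: "z \<in> rect \<longleftrightarrow> 0 \<le> z $ 1 \<and> z $ 1 \<le> p \<and> 0 \<le> z $ 2 \<and> z $ 2 \<le> 1"
  by (auto simp: mem_box_cart forall_2 vector_2)

lemma normal_map_has_derivative:
  obtains a b where "(normal_map has_derivative (\<lambda>h. h $ 1 *\<^sub>R a + h $ 2 *\<^sub>R b)) (at z)" "B a b = jacobian z"
proof
  define s t where "s = z $ 1" and "t = z $ 2"
  let ?a = "\<gamma>' s - ((t * radius s * k s) *\<^sub>R \<gamma>' s + (t * radius' s) *\<^sub>R \<eta> s)" and ?b = "- radius s *\<^sub>R \<eta> s"
  have nth: "((\<lambda>z :: real ^ 2. z $ i) has_derivative (\<lambda>h. h $ i)) (at z)" for i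
    by (rule bounded_linear.has_derivative[OF bounded_linear_vec_nth has_derivative_ident])
  have 1: "((\<lambda>z. \<gamma> (z $ 1)) has_derivative (\<lambda>h. h $ 1 *\<^sub>R \<gamma>' s)) (at z)"
    using has_derivative_compose[OF nth deriv_\<gamma>[unfolded has_vector_derivative_def]] by (simp add: s_def)
  have 2: "((\<lambda>z. \<eta> (z $ 1)) has_derivative (\<lambda>h. h $ 1 *\<^sub>R k s *\<^sub>R \<gamma>' s)) (at z)"
    using has_derivative_compose[OF nth deriv_\<eta>[unfolded has_vector_derivative_def]] by (simp add: s_def)
  have 3: "((\<lambda>z. radius (z $ 1)) has_derivative (\<lambda>h. radius' s * h $ 1)) (at z)"
    using has_derivative_compose[OF nth deriv_radius[unfolded has_field_derivative_def]] by (simp add: s_def)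
  have "(normal_map has_derivative (\<lambda>h. h $ 1 *\<^sub>R \<gamma>' s -
      ((z $ 2 * radius (z $ 1)) *\<^sub>R (h $ 1 *\<^sub>R k s *\<^sub>R \<gamma>' s) +
       (z $ 2 * (radius' s * h $ 1) + h $ 2 * radius (z $ 1)) *\<^sub>R \<eta> (z $ 1)))) (at z)"
    unfolding normal_map_def
    by (intro has_derivative_diff has_derivative_scaleR has_derivative_mult nth 1 2 3)
  also have "(\<lambda>h :: real ^ 2. h $ 1 *\<^sub>R \<gamma>' s -
      ((z $ 2 * radius (z $ 1)) *\<^sub>R (h $ 1 *\<^sub>R k s *\<^sub>R \<gamma>' s) +
       (z $ 2 * (radius' s * h $ 1) + h $ 2 * radius (z $ 1)) *\<^sub>R \<eta> (z $ 1))) =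
      (\<lambda>h. h $ 1 *\<^sub>R ?a + h $ 2 *\<^sub>R ?b)"
    by (simp add: fun_eq_iff s_def t_def algebra_simps)
  finally show "(normal_map has_derivative (\<lambda>h. h $ 1 *\<^sub>R ?a + h $ 2 *\<^sub>R ?b)) (at z)" .
  \<comment> \<open>The \<open>\<eta>\<close>-component of \<open>?a\<close> drops out because
    \<open>?b\<close> is a multiple of \<open>\<eta> s\<close>; the rest is \<open>(1 - t)\<close>
    times the pairing of \<open>\<gamma>'\<close> with \<open>?b\<close>.\<close>
  have "radius s * k s = 1" using k_pos[of s] by (simp add: radius_def)
  then show "B ?a ?b = jacobian z"
    using antisymmetric[of "\<gamma>' s" "\<eta> s"]
    by (simp add: jacobian_def diff_left add_left scaleR_left scaleR_right minus_right mult.assoc s_def t_def algebra_simps)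
qed

lemma coord_normal_map_has_derivative:
  assumes "\<bar>B u v\<bar> = 1"
  obtains G' where "\<And>z. ((\<lambda>z. coord u v (normal_map z)) has_derivative G' z) (at z)"
    "\<And>z. \<bar>det (matrix (G' z))\<bar> = \<bar>jacobian z\<bar>"
proof -
  have "\<exists>D. ((\<lambda>z. coord u v (normal_map z)) has_derivative D) (at z) \<and> \<bar>det (matrix D)\<bar> = \<bar>jacobian z\<bar>" for z
  proof -
    obtain a b where ab: "(normal_map has_derivative (\<lambda>h. h $ 1 *\<^sub>R a + h $ 2 *\<^sub>R b)) (at z)" "B a b = jacobian z"
      by (rule normal_map_has_derivative)
    have "((\<lambda>z. coord u v (normal_map z)) has_derivative (\<lambda>h. coord u v (h $ 1 *\<^sub>R a + h $ 2 *\<^sub>R b))) (at z)"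
      by (rule bounded_linear.has_derivative[OF bounded_linear_coord ab(1)])
    then show ?thesis
      using det_coord[OF assms, of a b] ab(2) by auto
  qed
  then show thesis using that by metis
qed

lemma continuous_on_jacobian: "continuous_on S jacobian"
  unfolding jacobian_def
  by (intro continuous_intros continuous_on_compose2[OF continuous_on_radius[of UNIV]]) auto

lemma jacobian_nonneg: "z \<in> rect \<Longrightarrow> jacobian z \<ge> 0"
  using radius_pos[of "z $ 1"] by (auto simp: jacobian_def mem_rect)

lemma jacobian_integrable: "compact S \<Longrightarrow> jacobian integrable_on S"
  using borel_integrable_compact[OF _ continuous_on_jacobian, of S] set_borel_integral_eq_integral(1)[of S jacobian]
  by (simp add: set_integrable_def)

lemma integral_jacobian: "integral rect jacobian = integral {0..p} radius / 2"
proof -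
  have "continuous_on (cbox (0, 0) (p, 1)) (\<lambda>x. (1 - snd x) * radius (fst x))"
    by (intro continuous_intros continuous_on_compose2[OF continuous_on_radius[of UNIV]]) auto
  from integral_vec_pair[OF this]
  have "integral rect jacobian = integral {0..p} (\<lambda>x. integral {0..1} (\<lambda>y. (1 - y) * radius x))"
    by (simp add: jacobian_def[abs_def])
  also have "(\<lambda>x. integral {0..1} (\<lambda>y. (1 - y) * radius x)) = (\<lambda>x. radius x / 2)"
  proof
    fix x
    have "((\<lambda>y. (1 - y) * radius x) has_integral ((1 - 1\<^sup>2 / 2) * radius x - (0 - 0\<^sup>2 / 2) * radius x)) {0..1}"
      by (rule fundamental_theorem_of_calculus)
        (auto intro!: derivative_eq_intros
          simp flip: has_real_derivative_iff_has_vector_derivative)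
    moreover have "(1 - 1\<^sup>2 / 2) * radius x - (0 - 0\<^sup>2 / 2) * radius x = radius x / 2"
      by simp
    ultimately show "integral {0..1} (\<lambda>y. (1 - y) * radius x) = radius x / 2"
      using integral_unique by metis
  qed
  finally show ?thesis by simp
qed

text \<open>Overlaps in the image only increase the right-hand side. The set \<open>S\<close> is a
  parameter since the equality case depends on how much of the rectangle the covering uses.\<close>

lemma area_le:
  assumes uv: "\<bar>B u v\<bar> = 1" and D: "open D" and S: "compact S" "S \<subseteq> rect" and cover: "D \<subseteq> normal_map ` S"
  shows "measure lebesgue {z :: real \<times> real. fst z *\<^sub>R u + snd z *\<^sub>R v \<in> D} \<le> integral S jacobian"
proof -
  obtain G' where G': "\<And>z. ((\<lambda>z. coord u v (normal_map z)) has_derivative G' z) (at z)"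
    "\<And>z. \<bar>det (matrix (G' z))\<bar> = \<bar>jacobian z\<bar>"
    using coord_normal_map_has_derivative[OF uv] by blast
  let ?G = "\<lambda>z. coord u v (normal_map z)"
  let ?A = "{z :: real ^ 2. z $ 1 *\<^sub>R u + z $ 2 *\<^sub>R v \<in> D}"
  have "open {z :: real \<times> real. fst z *\<^sub>R u + snd z *\<^sub>R v \<in> D}"
    using open_vimage[OF D, of "\<lambda>z :: real \<times> real. fst z *\<^sub>R u + snd z *\<^sub>R v"]
    by (simp add: vimage_def continuous_intros)
  from measure_vec_pair[OF this]
  have eq: "measure lebesgue {z :: real \<times> real. fst z *\<^sub>R u + snd z *\<^sub>R v \<in> D} = measure lebesgue ?A"
    by simp
  have "open ?A"
    using open_vimage[OF D, of "\<lambda>z :: real ^ 2. z $ 1 *\<^sub>R u + z $ 2 *\<^sub>R v"]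
    by (simp add: vimage_def continuous_intros)
  have "?A \<subseteq> ?G ` S"
  proof
    fix z assume "z \<in> ?A"
    then obtain y where "y \<in> S" "z $ 1 *\<^sub>R u + z $ 2 *\<^sub>R v = normal_map y" using cover by blast
    then show "z \<in> ?G ` S" using coord_combination[OF uv, of z] by (metis imageI)
  qed
  moreover have "continuous_on S ?G"
    using G'(1) by (meson continuous_at_imp_continuous_on has_derivative_continuous)
  then have "?G ` S \<in> lmeasurable"
    by (intro lmeasurable_compact compact_continuous_image S)
  ultimately have "measure lebesgue ?A \<le> measure lebesgue (?G ` S)"
    using \<open>open ?A\<close> by (intro measure_mono_fmeasurable) auto
  also have "\<dots> \<le> integral S (\<lambda>z. \<bar>det (matrix (G' z))\<bar>)"
  proof (rule measure_differentiable_image)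
    show "(\<lambda>z. \<bar>det (matrix (G' z))\<bar>) integrable_on S"
      unfolding G'(2) using S jacobian_nonneg by (intro integrable_eq[OF jacobian_integrable[OF S(1)]]) auto
    show "S \<in> sets lebesgue"
      using lmeasurable_compact[OF S(1)] by (rule fmeasurableD)
  qed (use G' in \<open>auto intro: has_derivative_at_withinI\<close>)
  also have "\<dots> = integral S jacobian"
    unfolding G'(2) using S jacobian_nonneg by (intro integral_cong) auto
  finally show ?thesis using eq by simp
qed

text \<open>Injectivity is required on the open rectangle: for a circle the two edges
  \<open>z $ 1 = 0\<close> and \<open>z $ 1 = p\<close> have the same image, and the edge
  \<open>z $ 2 = 1\<close> collapses to the centre.\<close>

lemma area_ge:
  assumes uv: "\<bar>B u v\<bar> = 1" and D: "open D" "D \<subseteq> normal_map ` rect"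
    and inj: "inj_on normal_map (box (vector [0, 0]) (vector [p, 1]))"
    and sub: "normal_map ` box (vector [0, 0]) (vector [p, 1]) \<subseteq> D"
  shows "measure lebesgue {z :: real \<times> real. fst z *\<^sub>R u + snd z *\<^sub>R v \<in> D} \<ge> integral rect jacobian"
proof -
  obtain G' where G': "\<And>z. ((\<lambda>z. coord u v (normal_map z)) has_derivative G' z) (at z)"
    "\<And>z. \<bar>det (matrix (G' z))\<bar> = \<bar>jacobian z\<bar>"
    using coord_normal_map_has_derivative[OF uv] by blast
  let ?G = "\<lambda>z. coord u v (normal_map z)" and ?U = "box (vector [0, 0]) (vector [p, 1]) :: (real ^ 2) set"
  let ?A = "{z :: real ^ 2. z $ 1 *\<^sub>R u + z $ 2 *\<^sub>R v \<in> D}"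
  have "open {z :: real \<times> real. fst z *\<^sub>R u + snd z *\<^sub>R v \<in> D}"
    using open_vimage[OF D(1), of "\<lambda>z :: real \<times> real. fst z *\<^sub>R u + snd z *\<^sub>R v"]
    by (simp add: vimage_def continuous_intros)
  from measure_vec_pair[OF this]
  have eq: "measure lebesgue {z :: real \<times> real. fst z *\<^sub>R u + snd z *\<^sub>R v \<in> D} = measure lebesgue ?A"
    by simp
  have "open ?A"
    using open_vimage[OF D(1), of "\<lambda>z :: real ^ 2. z $ 1 *\<^sub>R u + z $ 2 *\<^sub>R v"]
    by (simp add: vimage_def continuous_intros)
  have "?A \<subseteq> ?G ` rect"
  proof
    fix z assume "z \<in> ?A"
    then obtain y where "y \<in> rect" "z $ 1 *\<^sub>R u + z $ 2 *\<^sub>R v = normal_map y" using D(2) by blast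
    then show "z \<in> ?G ` rect" using coord_combination[OF uv, of z] by (metis imageI)
  qed
  moreover have "continuous_on rect ?G"
    using G'(1) by (meson continuous_at_imp_continuous_on has_derivative_continuous)
  then have "bounded (?G ` rect)"
    by (intro compact_imp_bounded compact_continuous_image compact_cbox)
  ultimately have "?A \<in> lmeasurable"
    using \<open>open ?A\<close> by (intro lmeasurable_open) (auto intro: bounded_subset)
  have "?G ` ?U \<in> lmeasurable \<and> measure lebesgue (?G ` ?U) = integral rect jacobian"
  proof (subst has_measure_differentiable_image)
    show "inj_on ?G ?U"
    proof (rule inj_onI)
      fix x y assume xy: "x \<in> ?U" "y \<in> ?U" "?G x = ?G y"
      then have "normal_map x = normal_map y" by (metis combination_coord[OF uv])
      then show "x = y" using inj xy by (simp add: inj_on_def)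
    qed
    have "(jacobian has_integral integral rect jacobian) rect"
      using jacobian_integrable[OF compact_cbox] by (rule integrable_integral)
    then have "(jacobian has_integral integral rect jacobian) ?U"
      by (simp only: has_integral_open_interval)
    then show "((\<lambda>z. \<bar>det (matrix (G' z))\<bar>) has_integral integral rect jacobian) ?U"
      unfolding G'(2) using jacobian_nonneg subsetD[OF box_subset_cbox]
      by (subst has_integral_cong[where g = jacobian]) (auto intro!: abs_of_nonneg)
  qed (use G' in \<open>auto intro: has_derivative_at_withinI\<close>)
  then have image: "?G ` ?U \<in> sets lebesgue" "measure lebesgue (?G ` ?U) = integral rect jacobian"
    by (auto dest: fmeasurableD)
  have "?G ` ?U \<subseteq> ?A"
    using sub combination_coord[OF uv] by auto
  then have "integral rect jacobian \<le> measure lebesgue ?A"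
    unfolding image(2)[symmetric]
    by (rule measure_mono_fmeasurable[OF _ image(1) \<open>?A \<in> lmeasurable\<close>])
  then show ?thesis using eq by simp
qed

end

section \<open>The Heintze-Karcher inequality\<close>

lemma ball_subset_inside_sphere:
  fixes a :: "'a::real_normed_vector"
  assumes "r > 0"
  shows "ball a r \<subseteq> inside (sphere a r)"
proof
  fix x assume x: "x \<in> ball a r"
  let ?C = "connected_component_set (- sphere a r) x"
  have "x \<in> ?C"
    using x by auto
  have "?C \<subseteq> - sphere a r"
    by (rule connected_component_subset)
  then have "?C \<inter> frontier (ball a r) = {}"
    unfolding frontier_ball[OF assms] by blast
  then have "?C \<subseteq> ball a r"
    using connected_Int_frontier[OF connected_connected_component] x \<open>x \<in> ?C\<close> by blast
  then have "bounded ?C"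
    using bounded_ball bounded_subset by blast
  then show "x \<in> inside (sphere a r)"
    using x by (auto simp: inside_def)
qed

context positively_curved_curve
begin

text \<open>On \<open>rect\<close> the left side of the inequality is the distance from
  \<open>normal_map z\<close> to its foot \<open>\<gamma> (z $ 1)\<close>, so this closed set
  collects the normals up to the point where the foot ceases to be nearest.\<close>

definition touching :: "(real ^ 2) set" where
  "touching = rect \<inter> (\<Inter>\<sigma>. {z. z $ 2 * radius (z $ 1) \<le> norm (\<gamma> \<sigma> - normal_map z)})"

lemma continuous_on_normal_map: "continuous_on S normal_map"
  unfolding normal_map_def
  by (intro continuous_intros continuous_on_compose2[OF continuous_on_\<gamma>[of UNIV]]
      continuous_on_compose2[OF continuous_on_\<eta>[of UNIV]] continuous_on_compose2[OF continuous_on_radius[of UNIV]]) auto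

lemma compact_touching: "compact touching"
  unfolding touching_def
  by (intro compact_Int_closed compact_cbox closed_INT ballI closed_Collect_le continuous_intros
      continuous_on_normal_map continuous_on_compose2[OF continuous_on_radius[of UNIV]]) auto

lemma touching_subset: "touching \<subseteq> rect"
  by (auto simp: touching_def)

lemma inside_subset_touching: "inside (range \<gamma>) \<subseteq> normal_map ` touching"
proof
  fix x assume "x \<in> inside (range \<gamma>)"
  then obtain s r where sr: "0 \<le> s" "s < p" "0 < r" "x = \<gamma> s - r *\<^sub>R \<eta> s" "k s * r \<le> 1"
    "\<And>\<sigma>. r \<le> norm (\<gamma> \<sigma> - x)"
    using inside_covered by metis
  let ?z = "vector [s, k s * r] :: real ^ 2"
  have r: "k s * r * radius s = r"
    using k_pos[of s] by (simp add: radius_def)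
  then have "normal_map ?z = x"
    by (simp add: normal_map_def sr(4))
  moreover have "?z \<in> touching"
  proof -
    have "?z $ 2 * radius (?z $ 1) \<le> norm (\<gamma> \<sigma> - normal_map ?z)" for \<sigma>
      unfolding \<open>normal_map ?z = x\<close> vector_2 r by (rule sr(6))
    moreover have "?z \<in> rect"
      using sr k_pos[of s] by (simp add: mem_rect less_imp_le)
    ultimately show ?thesis
      unfolding touching_def by blast
  qed
  ultimately show "x \<in> normal_map ` touching" by blast
qed

lemma open_inside_image: "open (inside (range \<gamma>))"
  by (intro open_inside compact_imp_closed compact_image)

text \<open>The complement of the closed set \<open>touching\<close>, once it meets the rectangle,
  also meets its interior. There it contains a box of positive content on which the Jacobian has a
  positive minimum.\<close>

lemma integral_touching_less:
  assumes "touching \<noteq> rect"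
  shows "integral touching jacobian < integral rect jacobian"
proof -
  let ?U = "box (vector [0, 0]) (vector [p, 1]) :: (real ^ 2) set"
  have "vector [p / 2, 1 / 2] \<in> ?U"
    using p_pos by (auto simp: mem_box_cart forall_2 vector_2)
  then have "?U \<noteq> {}" by blast
  then have "closure ?U = rect" by (rule closure_box)
  moreover obtain z0 where z0: "z0 \<in> rect" "z0 \<notin> touching"
    using assms touching_subset by blast
  moreover have "open (- touching)"
    using compact_touching by (simp add: compact_imp_closed open_Compl)
  ultimately have "?U \<inter> - touching \<noteq> {}"
    using open_Int_closure_eq_empty[of "- touching" ?U] by blast
  then obtain z1 where z1: "z1 \<in> ?U \<inter> - touching" by blast
  have "open (?U \<inter> - touching)"
    using \<open>open (- touching)\<close> by (intro open_Int open_box)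
  then obtain a b where ab: "cbox a b \<subseteq> ?U \<inter> - touching" "z1 \<in> box a b"
    using open_contains_cbox z1 by metis
  have "cbox a b \<noteq> {}" using ab(2) box_subset_cbox by blast
  from continuous_attains_inf[OF compact_cbox this continuous_on_jacobian]
  obtain z2 where z2: "z2 \<in> cbox a b" "\<And>z. z \<in> cbox a b \<Longrightarrow> jacobian z2 \<le> jacobian z" by blast
  have "z2 \<in> ?U" using z2(1) ab(1) by blast
  then have "jacobian z2 > 0"
    using radius_pos by (auto simp: jacobian_def mem_box_cart forall_2 vector_2)
  have "box a b \<noteq> {}" using ab(2) by blast
  then have "measure lborel (cbox a b) > 0"
    by (simp add: content_pos_lt_eq box_ne_empty)
  then have "0 < measure lborel (cbox a b) *\<^sub>R jacobian z2"
    using \<open>jacobian z2 > 0\<close> by simp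
  also have "\<dots> = integral (cbox a b) (\<lambda>_. jacobian z2)"
    by simp
  also have "\<dots> \<le> integral (cbox a b) jacobian"
    using z2(2) by (intro integral_le jacobian_integrable compact_cbox) auto
  finally have pos: "0 < integral (cbox a b) jacobian" .
  have disj: "touching \<inter> cbox a b = {}" using ab(1) by blast
  have "integral touching jacobian + integral (cbox a b) jacobian = integral (touching \<union> cbox a b) jacobian"
    using disj by (intro integral_Un[symmetric] jacobian_integrable compact_touching compact_cbox) auto
  also have "\<dots> \<le> integral rect jacobian"
  proof (rule integral_subset_le)
    show "touching \<union> cbox a b \<subseteq> rect"
      using touching_subset ab(1) box_subset_cbox by blast
  qed (auto intro!: jacobian_integrable compact_Un compact_touching compact_cbox jacobian_nonneg)
  finally show ?thesis using pos by simp
qed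

text \<open>The edge \<open>z $ 2 = 1\<close> of the rectangle is mapped to the centres of
  curvature.\<close>

lemma osculating_if_touching_eq_rect:
  assumes "touching = rect" "0 \<le> s" "s \<le> p"
  shows "radius s \<le> norm (\<gamma> \<sigma> - evolute s)"
proof -
  let ?z = "vector [s, 1] :: real ^ 2"
  have "?z \<in> touching"
    unfolding assms(1) using assms by (simp add: mem_rect)
  then have "?z $ 2 * radius (?z $ 1) \<le> norm (\<gamma> \<sigma> - normal_map ?z)"
    unfolding touching_def by blast
  then show ?thesis
    by (simp add: normal_map_def evolute_def)
qed

text \<open>For a circle \<open>normal_map\<close> is a system of polar coordinates about the
  centre: the norm recovers \<open>z $ 2\<close>, and injectivity of the curve recovers
  \<open>z $ 1\<close>.\<close>

lemma circle_area_ge: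
  assumes uv: "\<bar>B u v\<bar> = 1" and circle: "range \<gamma> = sphere a r" "r > 0"
  shows "measure lebesgue {z :: real \<times> real. fst z *\<^sub>R u + snd z *\<^sub>R v \<in> inside (range \<gamma>)} \<ge> integral rect jacobian"
proof (rule area_ge[OF uv open_inside_image])
  show "inside (range \<gamma>) \<subseteq> normal_map ` rect"
    using inside_subset_touching touching_subset by blast
  have normal_map: "normal_map z = a + (r * (1 - z $ 2)) *\<^sub>R \<eta> (z $ 1)" for z
    unfolding normal_map_def constant_curvature_if_circle[OF circle] by (simp add: algebra_simps)
  let ?U = "box (vector [0, 0]) (vector [p, 1]) :: (real ^ 2) set"
  have U: "0 < z $ 1" "z $ 1 < p" "0 < z $ 2" "z $ 2 < 1" if "z \<in> ?U" for z
    using that by (auto simp: mem_box_cart forall_2 vector_2)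
  have dist: "norm (normal_map z - a) = r * (1 - z $ 2)" if "z \<in> ?U" for z
    using U[OF that] circle(2) by (simp add: normal_map)
  show "inj_on normal_map ?U"
  proof (rule inj_onI)
    fix x y assume xy: "x \<in> ?U" "y \<in> ?U" "normal_map x = normal_map y"
    then have eq2: "x $ 2 = y $ 2"
      using dist[OF xy(1)] dist[OF xy(2)] circle(2) by simp
    then have "\<eta> (x $ 1) = \<eta> (y $ 1)"
      using xy(3) U[OF xy(1)] U[OF xy(2)] circle(2) by (simp add: normal_map)
    then have "\<gamma> (x $ 1) = \<gamma> (y $ 1)"
      using constant_curvature_if_circle(2)[OF circle, of "x $ 1"]
        constant_curvature_if_circle(2)[OF circle, of "y $ 1"] by simp
    then have "x $ 1 = y $ 1"
      by (rule inj_onD[OF inj]) (use U[OF xy(1)] U[OF xy(2)] in auto)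
    then show "x = y"
      using eq2 by (simp add: vec_eq_iff forall_2)
  qed
  show "normal_map ` ?U \<subseteq> inside (range \<gamma>)"
  proof
    fix w assume "w \<in> normal_map ` ?U"
    then obtain z where z: "z \<in> ?U" "w = normal_map z" by blast
    then have "norm (w - a) < r"
      using dist[OF z(1)] U[OF z(1)] circle(2) by simp
    then have "w \<in> ball a r"
      by (simp add: dist_norm norm_minus_commute)
    then show "w \<in> inside (range \<gamma>)"
      unfolding circle(1) using ball_subset_inside_sphere[OF circle(2)] by blast
  qed
qed

theorem heintze_karcher:
  assumes uv: "\<bar>B u v\<bar> = 1"
  defines "A \<equiv> measure lebesgue {z :: real \<times> real. fst z *\<^sub>R u + snd z *\<^sub>R v \<in> inside (range \<gamma>)}"
  shows "2 * A \<le> integral {0..p} radius"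
    and "2 * A = integral {0..p} radius \<longleftrightarrow> (\<exists>a r. r > 0 \<and> range \<gamma> = sphere a r)"
proof -
  have A_le: "A \<le> integral touching jacobian"
    unfolding A_def
    by (rule area_le[OF uv open_inside_image compact_touching touching_subset inside_subset_touching])
  also have "\<dots> \<le> integral rect jacobian"
    by (intro integral_subset_le touching_subset jacobian_integrable compact_touching compact_cbox ballI jacobian_nonneg)
  finally show le: "2 * A \<le> integral {0..p} radius"
    by (simp add: integral_jacobian)
  show "2 * A = integral {0..p} radius \<longleftrightarrow> (\<exists>a r. r > 0 \<and> range \<gamma> = sphere a r)"
  proof
    assume eq: "2 * A = integral {0..p} radius"
    have "touching = rect"
    proof (rule ccontr)
      assume "touching \<noteq> rect"
      from integral_touching_less[OF this] show False
        using A_le eq integral_jacobian by simp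
    qed
    from osculating_if_touching_eq_rect[OF this]
    have const: "radius s = radius 0" if "0 \<le> s" "s \<le> p" for s
      using constant_curvature that by blast
    have "integral {0..p} radius = integral {0..p} (\<lambda>_. radius 0)"
      by (rule integral_cong, rule const) auto
    also have "\<dots> > 0"
      using p_pos radius_pos[of 0] by simp
    \<comment> \<open>Positive area provides the enclosed point from which
      \<open>circle_if_constant_curvature\<close> starts.\<close>
    finally have "A > 0" using eq by simp
    then have "inside (range \<gamma>) \<noteq> {}"
      by (auto simp: A_def)
    from circle_if_constant_curvature[OF const this]
    show "\<exists>a r. r > 0 \<and> range \<gamma> = sphere a r"
      using radius_pos by blast
  next
    assume "\<exists>a r. r > 0 \<and> range \<gamma> = sphere a r"
    then obtain a r where "range \<gamma> = sphere a r" "r > 0" by blast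
    from circle_area_ge[OF uv this] have "integral rect jacobian \<le> A"
      by (simp add: A_def)
    then show "2 * A = integral {0..p} radius"
      using le integral_jacobian by simp
  qed
qed

end

section \<open>Choice of orientation and conclusion\<close>

lemma anti_norm_uminus: "anti_norm (\<lambda>x y. - \<omega> x y) = anti_norm \<omega>"
  if "bilinear \<omega>" for \<omega> :: "'a::real_normed_vector \<Rightarrow> 'a \<Rightarrow> real"
proof
  fix x
  have "(\<lambda>y. - \<omega> x y) ` sphere 0 1 = (\<lambda>y. \<omega> x (- y)) ` sphere 0 1"
    by (simp add: bilinear_rneg[OF that])
  also have "\<dots> = \<omega> x ` uminus ` sphere 0 1"
    by (simp add: image_image)
  also have "uminus ` sphere 0 1 = (sphere 0 1 :: 'a set)"
    by (auto intro!: image_eqI[of _ _ "- _"])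
  finally show "anti_norm (\<lambda>x y. - \<omega> x y) x = anti_norm \<omega> x"
    by (simp add: anti_norm_def)
qed

lemma symplectic_form_uminus:
  assumes "symplectic_form \<omega>"
  shows "symplectic_form (\<lambda>x y. - \<omega> x y)"
  using assms unfolding symplectic_form_def bilinear_def by (auto intro: linear_compose_neg)

lemma (in smooth_unit_circle) continuous_on_m: "continuous_on UNIV m"
proof -
  have "continuous_on UNIV \<phi>"
    by (intro continuous_at_imp_continuous_on ballI has_vector_derivative_continuous[OF deriv_\<phi>])
  then show ?thesis
    unfolding m_def by (intro continuous_on continuous_\<phi>')
qed

theorem theorem4p4:
  fixes \<omega> :: "'a::real_normed_vector \<Rightarrow> 'a \<Rightarrow> real"
    and \<phi> \<gamma> :: "real \<Rightarrow> 'a"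
    and k :: "real \<Rightarrow> real"
    and p :: real
  assumes "dim (UNIV :: 'a set) = 2"
    and "symplectic_form \<omega>"
    and "unit_circle_param \<phi>"
    and "smooth_simple_closed \<gamma> p"
    and "arc_length_param (anti_norm \<omega>) \<gamma>"
    and "circular_curvature \<phi> \<gamma> k"
    and "\<forall>s. k s > 0"
  shows "2 * area \<omega> (inside (\<gamma> ` {0..p}))
           \<le> integral {0..curve_length (anti_norm \<omega>) \<gamma> 0 p} (\<lambda>s. 1 / k s) \<and>
         (2 * area \<omega> (inside (\<gamma> ` {0..p}))
           = integral {0..curve_length (anti_norm \<omega>) \<gamma> 0 p} (\<lambda>s. 1 / k s) \<longleftrightarrow>
          (\<exists>a r. r > 0 \<and> \<gamma> ` {0..p} = sphere a r))"
proof -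
  obtain \<phi>' where \<phi>': "smooth \<phi>'" "\<And>t. (\<phi> has_vector_derivative \<phi>' t) (at t)"
    using assms(3) smooth_has_vector_derivative unfolding unit_circle_param_def by metis
  have circle: "smooth_unit_circle B \<phi> \<phi>'" if "symplectic_form B" for B :: "'a \<Rightarrow> 'a \<Rightarrow> real"
  proof -
    interpret symplectic_plane B
      by (rule symplectic_plane_if_symplectic_form[OF assms(1) that])
    show ?thesis
    proof
      show "(\<phi> has_vector_derivative \<phi>' t) (at t)" for t by (rule \<phi>'(2))
      show "norm (\<phi>' t) = 1" for t
        using assms(3) vector_derivative_at[OF \<phi>'(2), of t]
        unfolding unit_circle_param_def arc_length_param_def by metis
      show "range \<phi> = sphere 0 1"
        using assms(3) by (simp add: unit_circle_param_def)
      show "continuous_on UNIV \<phi>'"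
      proof -
        obtain \<phi>'' where "\<And>t. (\<phi>' has_vector_derivative \<phi>'' t) (at t)"
          using smooth_has_vector_derivative[OF \<phi>'(1)] by blast
        then show ?thesis
          by (intro continuous_at_imp_continuous_on ballI has_vector_derivative_continuous)
      qed
    qed
  qed
  interpret circle: smooth_unit_circle \<omega> \<phi> \<phi>'
    by (rule circle[OF assms(2)])
  \<comment> \<open>The choice made in \<open>area\<close> is realised by some pair:
    \<open>\<phi> 0\<close>, rescaled, and \<open>\<phi>' 0\<close>.\<close>
  obtain u v where uv: "(SOME (u, v). \<omega> u v = 1) = (u, v)" "\<omega> u v = 1"
  proof -
    let ?P = "\<lambda>(u, v). \<omega> u v = 1"
    have "?P ((1 / circle.m 0) *\<^sub>R \<phi> 0, \<phi>' 0)"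
      using circle.m_nonzero[of 0] by (simp add: circle.scaleR_left flip: circle.m_def)
    then have "?P (SOME z. ?P z)" by (rule someI)
    then show thesis
      using that by (cases "SOME z. ?P z") auto
  qed
  have length: "curve_length (anti_norm \<omega>) \<gamma> 0 p = p"
    using assms(4,5) by (simp add: curve_length_def arc_length_param_def smooth_simple_closed_def)
  \<comment> \<open>\<open>B\<close> is \<open>\<omega>\<close> or its negative, whichever makes
    \<open>\<phi>\<close> positively oriented. The basis \<open>u\<close>, \<open>v\<close> stays
    the one chosen for \<open>\<omega>\<close>, hence only
    \<open>\<bar>B u v\<bar> = 1\<close>.\<close>
  obtain B :: "'a \<Rightarrow> 'a \<Rightarrow> real" where B: "symplectic_form B" "anti_norm B = anti_norm \<omega>"
    "\<bar>B u v\<bar> = 1" "\<And>t. B (\<phi> t) (\<phi>' t) > 0"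
  proof (cases "\<forall>t. circle.m t > 0")
    case True
    show thesis
      by (rule that[of \<omega>]) (use True assms(2) uv in \<open>auto simp flip: circle.m_def\<close>)
  next
    case False
    then obtain t0 where t0: "circle.m t0 \<le> 0" by (auto simp: not_less)
    \<comment> \<open>\<open>circle.m\<close> is continuous without zeros, so one nonpositive value
      makes it negative throughout.\<close>
    have neg: "circle.m t < 0" for t
    proof (rule ccontr)
      assume "\<not> ?thesis"
      moreover have "connected (range circle.m)"
        by (intro connected_continuous_image circle.continuous_on_m connected_UNIV)
      ultimately have "0 \<in> range circle.m"
        using connectedD_interval[of "range circle.m" "circle.m t0" "circle.m t" 0] t0 by auto
      then show False using circle.m_nonzero by (metis imageE)
    qed
    show thesis
    proof (rule that[of "\<lambda>x y. - \<omega> x y"])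
      show "symplectic_form (\<lambda>x y. - \<omega> x y)"
        by (rule symplectic_form_uminus[OF assms(2)])
      show "anti_norm (\<lambda>x y. - \<omega> x y) = anti_norm \<omega>"
        using assms(2) by (intro anti_norm_uminus) (simp add: symplectic_form_def)
      show "- \<omega> (\<phi> t) (\<phi>' t) > 0" for t
        using neg[of t] by (simp add: circle.m_def)
    qed (use uv in auto)
  qed
  interpret B: smooth_unit_circle B \<phi> \<phi>'
    by (rule circle[OF B(1)])
  obtain \<gamma>' \<eta> k' where "positively_curved_curve B \<gamma> \<gamma>' \<eta> k k' p"
    using B.positively_curved_curve[of \<gamma> p k] assms(4-7) B(2,4) by (auto simp: B.m_def)
  then interpret curve: positively_curved_curve B \<gamma> \<gamma>' \<eta> k k' p .
  have "area \<omega> (inside (\<gamma> ` {0..p})) =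
      measure lebesgue {z :: real \<times> real. fst z *\<^sub>R u + snd z *\<^sub>R v \<in> inside (range \<gamma>)}"
    by (simp add: area_def uv(1) curve.image_period)
  then show ?thesis
    using curve.heintze_karcher[OF B(3)]
    unfolding length curve.image_period curve.radius_def[abs_def] by simp
qed

end
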